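(* As $n \to \infty$ and $(n-k) \to \infty$, $D_{n,k} - v_{n-k}^{\,k-1} D_{n-k+1} = o(D_{n,k})$, where the little-o is uniform: the ratio $(D_{n,k} - v_{n-k}^{k-1}D_{n-k+1})/D_{n,k}$ tends to $0$ as $n-k \to \infty$. In particular, for every fixed integer $k \geq 1$, $\frac{D_{n,k}}{D_n} \sim n^{-\binom{k}{2}}$ as $n \to \infty$.
   Context: A directed ordered acyclic graph (DOAG) is a tuple $(V, E, (\prec_v)_{v \in V \cup \{\emptyset\}})$ where $V$ is a finite set of vertices, $E \subseteq V \times V$ is a set of edges such that $(V,E)$ is acyclic, for each $v \in V$, $\prec_v$ is a total order on the outgoing edges of $v$, and $\prec_\emptyset$ is a total order on the sources (vertices with no incoming edge). Two DOAGs are equal if there is a bijection of vertex sets preserving edges and all orders. $D_n$ is the number of DOAGs with $n$ vertices (any number of edges and sources), and $D_{n,k}$ is the number of DOAGs with $n$ vertices and exactly $k$ sources (any number of edges and sinks). $v_\ell$ is the number of variations of size $\ell$, where a variation of size $\ell$ is a sequence of $\ell$ non-negative integers in which each positive integer appears at most once and, if $0<i<j$ and $j$ appears, then $i$ appears. *)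

theory Defs
  imports Complex_Main "HOL-Library.Landau_Symbols"
begin

record 'a doag =
  verts :: "'a set"
  edges :: "('a \<times> 'a) set"
  out_ord :: "'a \<Rightarrow> (('a \<times> 'a) \<times> ('a \<times> 'a)) set"
  src_ord :: "('a \<times> 'a) set"

definition out_edges :: "'a doag \<Rightarrow> 'a \<Rightarrow> ('a \<times> 'a) set" where
  "out_edges G v = {e \<in> edges G. fst e = v}"

definition sources :: "'a doag \<Rightarrow> 'a set" where
  "sources G = {v \<in> verts G. \<forall>u. (u, v) \<notin> edges G}"

text \<open>Total orders are encoded by their strict part. \<^const>\<open>strict_linear_order_on\<close> does not
  confine the relation to the carrier, so this is demanded separately. The family of orders is
  indexed by the vertices only, hence \<^const>\<open>out_ord\<close> is required to be empty elsewhere.\<close>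

definition strict_total_order :: "'a set \<Rightarrow> ('a \<times> 'a) set \<Rightarrow> bool" where
  "strict_total_order A r \<longleftrightarrow> r \<subseteq> A \<times> A \<and> strict_linear_order_on A r"

definition is_doag :: "'a doag \<Rightarrow> bool" where
  "is_doag G \<longleftrightarrow>
     finite (verts G) \<and>
     edges G \<subseteq> verts G \<times> verts G \<and>
     acyclic (edges G) \<and>
     (\<forall>v\<in>verts G. strict_total_order (out_edges G v) (out_ord G v)) \<and>
     (\<forall>v. v \<notin> verts G \<longrightarrow> out_ord G v = {}) \<and>
     strict_total_order (sources G) (src_ord G)"

definition doag_iso :: "('a \<Rightarrow> 'b) \<Rightarrow> 'a doag \<Rightarrow> 'b doag \<Rightarrow> bool" where
  "doag_iso f G H \<longleftrightarrow>
     bij_betw f (verts G) (verts H) \<and>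
     (\<forall>u\<in>verts G. \<forall>v\<in>verts G. (u, v) \<in> edges G \<longleftrightarrow> (f u, f v) \<in> edges H) \<and>
     (\<forall>v\<in>verts G. \<forall>d\<in>out_edges G v. \<forall>e\<in>out_edges G v.
        (d, e) \<in> out_ord G v \<longleftrightarrow> (map_prod f f d, map_prod f f e) \<in> out_ord H (f v)) \<and>
     (\<forall>s\<in>sources G. \<forall>t\<in>sources G. (s, t) \<in> src_ord G \<longleftrightarrow> (f s, f t) \<in> src_ord H)"

text \<open>DOAGs are counted up to isomorphism. Every finite vertex set embeds into the naturals, so
  it suffices to take vertices from there; the quotients below are finite
  (\<open>finite_doags\<close> and \<open>finite_doags_src\<close>), so their cardinalities are the true ones.\<close>

definition doag_equiv :: "(nat doag \<times> nat doag) set" where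
  "doag_equiv = {(G, H). is_doag G \<and> is_doag H \<and> (\<exists>f. doag_iso f G H)}"

definition num_doags :: "nat \<Rightarrow> nat" where
  "num_doags n = card ({G. is_doag G \<and> card (verts G) = n} // doag_equiv)"

definition num_doags_src :: "nat \<Rightarrow> nat \<Rightarrow> nat" where
  "num_doags_src n k =
     card ({G. is_doag G \<and> card (verts G) = n \<and> card (sources G) = k} // doag_equiv)"

definition is_variation :: "nat list \<Rightarrow> bool" where
  "is_variation xs \<longleftrightarrow>
     (\<forall>i>0. count_list xs i \<le> 1) \<and>
     (\<forall>i j. 0 < i \<and> i < j \<and> j \<in> set xs \<longrightarrow> i \<in> set xs)"

definition num_variations :: "nat \<Rightarrow> nat" where
  "num_variations l = card {xs. length xs = l \<and> is_variation xs}"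

text \<open>The filter on pairs \<open>(n, k)\<close> with \<open>k \<ge> 1\<close> along which \<open>n - k\<close> tends to infinity (and then so
  does \<open>n\<close>), uniformly in \<open>k\<close>. Truncated subtraction is harmless: eventually \<open>n - k > 0\<close>.\<close>

definition gap_at_top :: "(nat \<times> nat) filter" where
  "gap_at_top = inf (filtercomap (\<lambda>(n, k). n - k) at_top) (principal {(n, k). k \<ge> 1})"

lemma eventually_gap_at_top:
  "eventually P gap_at_top \<longleftrightarrow> (\<exists>M. \<forall>n k. k \<ge> 1 \<and> n - k \<ge> M \<longrightarrow> P (n, k))"
proof
  assume "eventually P gap_at_top"
  then obtain Q where Q: "eventually Q at_top"
      "\<And>n k. Q (n - k) \<Longrightarrow> k \<ge> 1 \<Longrightarrow> P (n, k)"
    unfolding gap_at_top_def eventually_inf_principal eventually_filtercomap by auto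
  then show "\<exists>M. \<forall>n k. k \<ge> 1 \<and> n - k \<ge> M \<longrightarrow> P (n, k)"
    unfolding eventually_at_top_linorder by blast
next
  assume "\<exists>M. \<forall>n k. k \<ge> 1 \<and> n - k \<ge> M \<longrightarrow> P (n, k)"
  then obtain M where M: "\<And>n k. k \<ge> 1 \<Longrightarrow> n - k \<ge> M \<Longrightarrow> P (n, k)" by blast
  show "eventually P gap_at_top"
    unfolding gap_at_top_def eventually_inf_principal eventually_filtercomap
    by (rule exI[of _ "\<lambda>m. m \<ge> M"]) (use M in \<open>auto simp: eventually_ge_at_top\<close>)
qed

lemma out_edges_sub: "is_doag G \<Longrightarrow> e \<in> out_edges G v \<Longrightarrow>
    v \<in> verts G \<and> (\<exists>w\<in>verts G. e = (v, w))"
  unfolding is_doag_def out_edges_def by auto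

lemma doag_iso_source:
  assumes "is_doag G" "is_doag H" "doag_iso f G H" "v \<in> verts G"
  shows "f v \<in> sources H \<longleftrightarrow> v \<in> sources G"
proof -
  have E: "edges G \<subseteq> verts G \<times> verts G" "edges H \<subseteq> verts H \<times> verts H"
    using assms unfolding is_doag_def by auto
  have B: "f ` verts G = verts H" using assms(3) unfolding doag_iso_def bij_betw_def by auto
  have I: "\<And>u. u \<in> verts G \<Longrightarrow> (u, v) \<in> edges G \<longleftrightarrow> (f u, f v) \<in> edges H"
    using assms(3,4) unfolding doag_iso_def by blast
  have "(\<exists>u. (u, v) \<in> edges G) \<longleftrightarrow> (\<exists>u. (u, f v) \<in> edges H)"
  proof
    assume "\<exists>u. (u, v) \<in> edges G"
    then show "\<exists>u. (u, f v) \<in> edges H" using E(1) I by blast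
  next
    assume "\<exists>u. (u, f v) \<in> edges H"
    then obtain w where w: "(w, f v) \<in> edges H" by blast
    then obtain u where "u \<in> verts G" "w = f u" using E(2) B by blast
    with w I show "\<exists>u. (u, v) \<in> edges G" by blast
  qed
  then show ?thesis unfolding sources_def using B assms(4) by auto
qed

lemma doag_iso_sources:
  assumes "is_doag G" "is_doag H" "doag_iso f G H"
  shows "bij_betw f (sources G) (sources H)"
proof -
  have b: "bij_betw f (verts G) (verts H)" using assms(3) unfolding doag_iso_def by auto
  have i: "sources G \<subseteq> verts G" "sources H \<subseteq> verts H" unfolding sources_def by auto
  have B: "f ` verts G = verts H" using b unfolding bij_betw_def by auto
  have "f ` sources G = sources H"
  proof (intro equalityI subsetI)
    fix x assume "x \<in> f ` sources G"
    then show "x \<in> sources H" using doag_iso_source[OF assms] i by auto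
  next
    fix x assume x: "x \<in> sources H"
    then obtain v where "v \<in> verts G" "x = f v" using i B by blast
    with x show "x \<in> f ` sources G" using doag_iso_source[OF assms] by auto
  qed
  moreover have "inj_on f (sources G)"
    using b i(1) inj_on_subset unfolding bij_betw_def by metis
  ultimately show ?thesis unfolding bij_betw_def by blast
qed

lemma doag_iso_out_edges:
  assumes "is_doag G" "is_doag H" "doag_iso f G H" "d \<in> out_edges G v"
  shows "map_prod f f d \<in> out_edges H (f v)"
proof -
  obtain w where "d = (v, w)" "v \<in> verts G" "w \<in> verts G"
    using out_edges_sub[OF assms(1,4)] by blast
  then show ?thesis using assms(3,4) unfolding doag_iso_def out_edges_def by auto
qed

lemma doag_iso_refl: "doag_iso id G G"
  unfolding doag_iso_def by (auto simp: map_prod.id)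

lemma doag_iso_trans:
  assumes "is_doag G" "is_doag H" "is_doag K" "doag_iso f G H" "doag_iso g H K"
  shows "doag_iso (g \<circ> f) G K"
proof -
  have bf: "bij_betw f (verts G) (verts H)" and bg: "bij_betw g (verts H) (verts K)"
    using assms(4,5) unfolding doag_iso_def by auto
  have fv: "\<And>v. v \<in> verts G \<Longrightarrow> f v \<in> verts H" using bf bij_betwE by blast
  have fs: "\<And>v. v \<in> sources G \<Longrightarrow> f v \<in> sources H"
    using doag_iso_sources[OF assms(1,2,4)] bij_betwE by blast
  have fe: "\<And>d v. d \<in> out_edges G v \<Longrightarrow> map_prod f f d \<in> out_edges H (f v)"
    using doag_iso_out_edges[OF assms(1,2,4)] .
  show ?thesis
    unfolding doag_iso_def
  proof (intro conjI ballI)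
    show "bij_betw (g \<circ> f) (verts G) (verts K)" using bf bg by (rule bij_betw_trans)
  next
    fix u v assume "u \<in> verts G" "v \<in> verts G"
    then show "(u, v) \<in> edges G \<longleftrightarrow> ((g \<circ> f) u, (g \<circ> f) v) \<in> edges K"
      using assms(4,5) fv unfolding doag_iso_def by simp
  next
    fix v d e assume a: "v \<in> verts G" "d \<in> out_edges G v" "e \<in> out_edges G v"
    have "(d, e) \<in> out_ord G v \<longleftrightarrow> (map_prod f f d, map_prod f f e) \<in> out_ord H (f v)"
      using assms(4) a unfolding doag_iso_def by blast
    also have "\<dots> \<longleftrightarrow> (map_prod g g (map_prod f f d), map_prod g g (map_prod f f e)) \<in> out_ord K (g (f v))"
      using assms(5) fv[OF a(1)] fe[OF a(2)] fe[OF a(3)] unfolding doag_iso_def by blast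
    finally show "(d, e) \<in> out_ord G v \<longleftrightarrow>
        (map_prod (g \<circ> f) (g \<circ> f) d, map_prod (g \<circ> f) (g \<circ> f) e) \<in> out_ord K ((g \<circ> f) v)"
      by (simp add: prod.map_comp)
  next
    fix s t assume "s \<in> sources G" "t \<in> sources G"
    then show "(s, t) \<in> src_ord G \<longleftrightarrow> ((g \<circ> f) s, (g \<circ> f) t) \<in> src_ord K"
      using assms(4,5) fs unfolding doag_iso_def by simp
  qed
qed

lemma doag_iso_sym:
  assumes G: "is_doag G" and H: "is_doag H" and f: "doag_iso f G H"
  shows "doag_iso (inv_into (verts G) f) H G"
proof -
  define g where "g = inv_into (verts G) f"
  have bf: "bij_betw f (verts G) (verts H)" using f unfolding doag_iso_def by auto
  have bg: "bij_betw g (verts H) (verts G)" unfolding g_def by (rule bij_betw_inv_into[OF bf])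
  have fg: "\<And>v. v \<in> verts H \<Longrightarrow> f (g v) = v"
    unfolding g_def using bf by (rule bij_betw_inv_into_right)
  have gv: "\<And>v. v \<in> verts H \<Longrightarrow> g v \<in> verts G" using bg bij_betwE by blast
  have gs: "g v \<in> sources G" if "v \<in> sources H" for v
  proof -
    have "v \<in> verts H" using that unfolding sources_def by auto
    with that show ?thesis using doag_iso_source[OF G H f gv] fg by simp
  qed
  have ee: "(g u, g v) \<in> edges G \<longleftrightarrow> (u, v) \<in> edges H" if "u \<in> verts H" "v \<in> verts H" for u v
  proof -
    have "(g u, g v) \<in> edges G \<longleftrightarrow> (f (g u), f (g v)) \<in> edges H"
      using f gv[OF that(1)] gv[OF that(2)] unfolding doag_iso_def by blast
    then show ?thesis using fg that by metis
  qed
  have ge: "map_prod g g d \<in> out_edges G (g v) \<and> map_prod f f (map_prod g g d) = d"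
    if d: "d \<in> out_edges H v" for d v
  proof -
    obtain w where "d = (v, w)" "v \<in> verts H" "w \<in> verts H"
      using out_edges_sub[OF H d] by blast
    then show ?thesis using d ee fg unfolding out_edges_def by auto
  qed
  have "doag_iso g H G"
    unfolding doag_iso_def
  proof (intro conjI ballI)
    fix v d e assume a: "v \<in> verts H" "d \<in> out_edges H v" "e \<in> out_edges H v"
    have "(map_prod g g d, map_prod g g e) \<in> out_ord G (g v) \<longleftrightarrow>
        (map_prod f f (map_prod g g d), map_prod f f (map_prod g g e)) \<in> out_ord H (f (g v))"
      using f gv[OF a(1)] ge[OF a(2)] ge[OF a(3)] unfolding doag_iso_def by blast
    then show "(d, e) \<in> out_ord H v \<longleftrightarrow> (map_prod g g d, map_prod g g e) \<in> out_ord G (g v)"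
      using ge[OF a(2)] ge[OF a(3)] fg[OF a(1)] by simp
  next
    fix s t assume a: "s \<in> sources H" "t \<in> sources H"
    then have "s \<in> verts H" "t \<in> verts H" unfolding sources_def by auto
    moreover have "(g s, g t) \<in> src_ord G \<longleftrightarrow> (f (g s), f (g t)) \<in> src_ord H"
      using f gs[OF a(1)] gs[OF a(2)] unfolding doag_iso_def by blast
    ultimately show "(s, t) \<in> src_ord H \<longleftrightarrow> (g s, g t) \<in> src_ord G"
      using fg by metis
  qed (use bg ee in auto)
  then show ?thesis unfolding g_def .
qed

lemma equiv_doag: "equiv {G. is_doag G} doag_equiv"
proof (rule equivI)
  show "doag_equiv \<subseteq> {G. is_doag G} \<times> {G. is_doag G}" unfolding doag_equiv_def by auto
  show "refl_on {G. is_doag G} doag_equiv"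
    unfolding refl_on_def doag_equiv_def using doag_iso_refl by auto
  show "sym doag_equiv"
    unfolding sym_def doag_equiv_def using doag_iso_sym by blast
  show "trans doag_equiv"
    unfolding trans_def doag_equiv_def using doag_iso_trans by blast
qed

lemma finite_doags_on: "finite {G :: nat doag. is_doag G \<and> verts G = {..<n}}"
proof -
  let ?V = "{..<n}"
  let ?O = "Pow ((?V \<times> ?V) \<times> (?V \<times> ?V))"
  have fin: "finite {h :: nat \<Rightarrow> ((nat \<times> nat) \<times> nat \<times> nat) set.
      \<forall>v. (v \<in> ?V \<longrightarrow> h v \<in> ?O) \<and> (v \<notin> ?V \<longrightarrow> h v = {})}" (is "finite ?F")
    by (rule finite_set_of_finite_funs) auto
  have "{G :: nat doag. is_doag G \<and> verts G = ?V} \<subseteq>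
      (\<lambda>(E, h, r). \<lparr>verts = ?V, edges = E, out_ord = h, src_ord = r\<rparr>) `
        (Pow (?V \<times> ?V) \<times> ?F \<times> Pow (?V \<times> ?V))"
  proof
    fix G :: "nat doag" assume "G \<in> {G. is_doag G \<and> verts G = ?V}"
    then have G: "is_doag G" "verts G = ?V" by auto
    have "edges G \<in> Pow (?V \<times> ?V)" using G unfolding is_doag_def by auto
    moreover have "src_ord G \<in> Pow (?V \<times> ?V)"
      using G unfolding is_doag_def strict_total_order_def sources_def by blast
    moreover have "out_ord G \<in> ?F"
    proof -
      have "out_ord G v \<subseteq> (?V \<times> ?V) \<times> (?V \<times> ?V)" if v: "v \<in> ?V" for v
      proof -
        have "out_ord G v \<subseteq> out_edges G v \<times> out_edges G v"
          using G v unfolding is_doag_def strict_total_order_def by blast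
        moreover have "out_edges G v \<subseteq> ?V \<times> ?V"
          using G unfolding is_doag_def out_edges_def by auto
        ultimately show ?thesis by blast
      qed
      moreover have "out_ord G v = {}" if "v \<notin> ?V" for v
        using G that unfolding is_doag_def by auto
      ultimately show ?thesis by blast
    qed
    ultimately show "G \<in> (\<lambda>(E, h, r). \<lparr>verts = ?V, edges = E, out_ord = h, src_ord = r\<rparr>) `
        (Pow (?V \<times> ?V) \<times> ?F \<times> Pow (?V \<times> ?V))"
      using G(2) by (intro image_eqI[of _ _ "(edges G, out_ord G, src_ord G)"]) auto
  qed
  then show ?thesis by (rule finite_subset) (use fin in auto)
qed

lemma strict_total_order_image:
  assumes "inj f" "strict_total_order A r"
  shows "strict_total_order (f ` A) (map_prod f f ` r)"
proof -
  have r: "r \<subseteq> A \<times> A" "trans r" "irrefl r" "total_on A r"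
    using assms(2) unfolding strict_total_order_def strict_linear_order_on_def by auto
  have m: "(f a, f b) \<in> map_prod f f ` r \<longleftrightarrow> (a, b) \<in> r" for a b
    using assms(1) by (auto simp: inj_eq)
  have ran: "\<exists>a b. x = f a \<and> y = f b \<and> (a, b) \<in> r" if "(x, y) \<in> map_prod f f ` r" for x y
    using that by auto
  have "trans (map_prod f f ` r)"
  proof (rule transI)
    fix x y z assume xy: "(x, y) \<in> map_prod f f ` r" and yz: "(y, z) \<in> map_prod f f ` r"
    obtain a b where ab: "x = f a" "y = f b" "(a, b) \<in> r" using ran[OF xy] by blast
    obtain c d where cd: "y = f c" "z = f d" "(c, d) \<in> r" using ran[OF yz] by blast
    have "b = c" using ab(2) cd(1) assms(1) by (simp add: inj_eq)
    then have "(a, d) \<in> r" using ab(3) cd(3) r(2) by (meson transD)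
    then show "(x, z) \<in> map_prod f f ` r" using m ab(1) cd(2) by blast
  qed
  moreover have "irrefl (map_prod f f ` r)"
  proof (rule irreflI)
    fix x show "(x, x) \<notin> map_prod f f ` r"
    proof
      assume "(x, x) \<in> map_prod f f ` r"
      then obtain a b where "x = f a" "x = f b" "(a, b) \<in> r" using ran by blast
      then show False using assms(1) r(3) by (metis inj_eq irrefl_def)
    qed
  qed
  moreover have "total_on (f ` A) (map_prod f f ` r)"
  proof (rule total_onI)
    fix x y assume "x \<in> f ` A" "y \<in> f ` A" and ne: "x \<noteq> y"
    then obtain a b where "x = f a" "y = f b" "a \<in> A" "b \<in> A" by blast
    with ne r(4) m show "(x, y) \<in> map_prod f f ` r \<or> (y, x) \<in> map_prod f f ` r"
      unfolding total_on_def by metis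
  qed
  moreover have "map_prod f f ` r \<subseteq> f ` A \<times> f ` A" using r(1) by auto
  ultimately show ?thesis unfolding strict_total_order_def strict_linear_order_on_def by blast
qed

lemma acyclic_image:
  assumes "inj f" "acyclic r"
  shows "acyclic (map_prod f f ` r)"
proof -
  have "\<exists>a b. x = f a \<and> y = f b \<and> (a, b) \<in> r\<^sup>+" if "(x, y) \<in> (map_prod f f ` r)\<^sup>+" for x y
    using that
  proof (induction rule: trancl_induct)
    case (base y)
    then show ?case by auto
  next
    case (step y z)
    then obtain a b c d where "x = f a" "y = f b" "(a, b) \<in> r\<^sup>+"
        "y = f c" "z = f d" "(c, d) \<in> r" by auto
    moreover from this have "b = c" using assms(1) by (simp add: inj_eq)
    ultimately show ?case by (metis trancl.trancl_into_trancl)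
  qed
  then show ?thesis using assms unfolding acyclic_def by (metis inj_eq)
qed

lemma doag_canonical:
  fixes G :: "nat doag"
  assumes G: "is_doag G" and n: "card (verts G) = n"
  obtains H :: "nat doag" where "is_doag H" "verts H = {..<n}" "(G, H) \<in> doag_equiv"
proof -
  have fin: "finite (verts G)" using G unfolding is_doag_def by auto
  obtain h where h: "bij_betw h (verts G) {..<n}"
    using ex_bij_betw_finite_nat[OF fin] n by (auto simp: lessThan_atLeast0)
  define f where "f v = (if v \<in> verts G then h v else v + n)" for v
  have hv: "h v < n" if "v \<in> verts G" for v using h that bij_betwE by blast
  have f: "inj f"
  proof (rule injI)
    fix x y assume "f x = f y"
    then show "x = y"
      using hv[of x] hv[of y] h unfolding f_def bij_betw_def inj_on_def
      by (auto split: if_splits)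
  qed
  have fV: "f ` verts G = {..<n}"
    using h unfolding bij_betw_def f_def by auto
  have fV': "f v < n \<longleftrightarrow> v \<in> verts G" for v
    unfolding f_def using hv by auto
  let ?f = "map_prod f f"
  have ff: "inj ?f" using f by (simp add: prod.inj_map)
  define H where "H = \<lparr>verts = {..<n}, edges = ?f ` edges G,
    out_ord = (\<lambda>w. if w < n then map_prod ?f ?f ` out_ord G (inv f w) else {}),
    src_ord = ?f ` src_ord G\<rparr>"
  have oH: "out_ord H (f v) = map_prod ?f ?f ` out_ord G v" if "v \<in> verts G" for v
    using that fV' inv_f_f[OF f] unfolding H_def by simp
  have eH: "(f u, f v) \<in> edges H \<longleftrightarrow> (u, v) \<in> edges G" for u v
    unfolding H_def using f by (auto simp: inj_eq)
  have eH': "edges H = ?f ` edges G" "verts H = f ` verts G" "src_ord H = ?f ` src_ord G"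
    unfolding H_def using fV by auto
  have outH: "out_edges H (f v) = ?f ` out_edges G v" for v
    unfolding out_edges_def eH' using f by (auto simp: inj_eq)
  have EG: "edges G \<subseteq> verts G \<times> verts G" using G unfolding is_doag_def by auto
  have srcH: "sources H = f ` sources G"
  proof -
    have "f v \<in> sources H \<longleftrightarrow> v \<in> sources G" if "v \<in> verts G" for v
    proof -
      have "(\<exists>w. (w, f v) \<in> edges H) \<longleftrightarrow> (\<exists>u. (u, v) \<in> edges G)"
      proof
        assume "\<exists>w. (w, f v) \<in> edges H"
        then obtain w where w: "(w, f v) \<in> edges H" by blast
        then obtain u where "w = f u" unfolding eH' by auto
        with w show "\<exists>u. (u, v) \<in> edges G" using eH by blast
      qed (use eH in blast)
      moreover have "f v \<in> verts H" using that unfolding eH'(2) by blast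
      ultimately show ?thesis using that unfolding sources_def by blast
    qed
    moreover have "sources H \<subseteq> f ` verts G" "sources G \<subseteq> verts G"
      unfolding sources_def eH' by auto
    ultimately show ?thesis by blast
  qed
  have H: "is_doag H"
    unfolding is_doag_def
  proof (intro conjI ballI allI impI)
    show "finite (verts H)" unfolding H_def by simp
    show "edges H \<subseteq> verts H \<times> verts H" unfolding eH' using EG by auto
    show "acyclic (edges H)"
      unfolding eH' by (rule acyclic_image[OF f]) (use G in \<open>auto simp: is_doag_def\<close>)
    show "strict_total_order (sources H) (src_ord H)"
      unfolding srcH eH'
      by (rule strict_total_order_image[OF f]) (use G in \<open>auto simp: is_doag_def\<close>)
    show "out_ord H v = {}" if "v \<notin> verts H" for v
      using that unfolding H_def by auto
  next
    fix w assume "w \<in> verts H"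
    then obtain v where v: "w = f v" "v \<in> verts G" unfolding eH' by blast
    show "strict_total_order (out_edges H w) (out_ord H w)"
      unfolding v(1) outH oH[OF v(2)]
      by (rule strict_total_order_image[OF ff]) (use G v(2) in \<open>auto simp: is_doag_def\<close>)
  qed
  have "doag_iso f G H"
    unfolding doag_iso_def
  proof (intro conjI ballI)
    show "bij_betw f (verts G) (verts H)"
      unfolding bij_betw_def eH' using f inj_on_subset by blast
  next
    fix u v show "(u, v) \<in> edges G \<longleftrightarrow> (f u, f v) \<in> edges H" using eH by blast
  next
    fix v d e assume "v \<in> verts G"
    then show "(d, e) \<in> out_ord G v \<longleftrightarrow> (?f d, ?f e) \<in> out_ord H (f v)"
      unfolding oH[OF \<open>v \<in> verts G\<close>] using inj_image_mem_iff[of "map_prod ?f ?f" "(d, e)"] ff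
      by (simp add: prod.inj_map)
  next
    fix s t show "(s, t) \<in> src_ord G \<longleftrightarrow> (f s, f t) \<in> src_ord H"
      unfolding eH' using inj_image_mem_iff[OF ff, of "(s, t)"] by simp
  qed
  then have "(G, H) \<in> doag_equiv" using G H unfolding doag_equiv_def by blast
  moreover have "verts H = {..<n}" unfolding H_def by simp
  ultimately show ?thesis using that H by blast
qed

lemma finite_doags: "finite ({G. is_doag G \<and> card (verts G) = n} // doag_equiv)"
proof (rule finite_subset)
  let ?C = "{G :: nat doag. is_doag G \<and> verts G = {..<n}}"
  show "{G. is_doag G \<and> card (verts G) = n} // doag_equiv \<subseteq> (\<lambda>G. doag_equiv `` {G}) ` ?C"
  proof
    fix X assume "X \<in> {G. is_doag G \<and> card (verts G) = n} // doag_equiv"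
    then obtain G where G: "is_doag G" "card (verts G) = n" "X = doag_equiv `` {G}"
      by (auto elim: quotientE)
    obtain H where H: "is_doag H" "verts H = {..<n}" "(G, H) \<in> doag_equiv"
      using doag_canonical[OF G(1,2)] .
    have "X = doag_equiv `` {H}" unfolding G(3) using equiv_class_eq[OF equiv_doag H(3)] .
    then show "X \<in> (\<lambda>G. doag_equiv `` {G}) ` ?C" using H by blast
  qed
  show "finite ((\<lambda>G. doag_equiv `` {G}) ` ?C)" using finite_doags_on by (rule finite_imageI)
qed

lemma finite_doags_src:
  "finite ({G. is_doag G \<and> card (verts G) = n \<and> card (sources G) = k} // doag_equiv)"
  by (rule finite_subset[OF _ finite_doags[of n]]) (auto simp: quotient_def)

lemma finite_variations: "finite {xs. length xs = l \<and> is_variation xs}"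
proof (rule finite_subset)
  show "{xs. length xs = l \<and> is_variation xs} \<subseteq> {xs. set xs \<subseteq> {..l} \<and> length xs = l}"
  proof (intro subsetI CollectI conjI)
    fix xs j assume xs: "xs \<in> {xs. length xs = l \<and> is_variation xs}" and j: "j \<in> set xs"
    have "i \<in> set xs" if "i \<in> {1..j}" for i
    proof (cases "i = j")
      case False
      then have "0 < i" "i < j" using that by auto
      then show ?thesis using xs j unfolding is_variation_def by blast
    qed (use j in simp)
    then have "card {1..j} \<le> card (set xs)" by (intro card_mono) auto
    then show "j \<in> {..l}" using card_length[of xs] xs by auto
  qed auto
  show "finite {xs. set xs \<subseteq> {..l} \<and> length xs = l}" by (rule finite_lists_length_eq) simp
qed

end

theory Submission
  imports Defs
begin

text \<open>Deleting the smallest source of a DOAG with at least \<open>k\<close> sources, and appending the sources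
  thus uncovered, leaves a DOAG with at least \<open>k - 1\<close> sources; what is forgotten is a word of
  distinct letters (a variation) over the vertices that are not among the first \<open>k\<close> sources. Hence
  \<open>D\<^bsub>n,\<ge>k\<^esub> \<le> v\<^bsub>n-k\<^esub> D\<^bsub>n-1,\<ge>k-1\<^esub>\<close>. Conversely, inserting a new first source is injective if it
  covers no source, or if it covers the only one, so that \<open>D\<^bsub>n,k\<^esub> \<ge> v\<^bsub>n-k\<^esub> D\<^bsub>n-1,k-1\<^esub>\<close> and
  \<open>D\<^bsub>n,1\<^esub> \<ge> (v\<^bsub>n-1\<^esub> - v\<^bsub>n-2\<^esub>) D\<^bsub>n-1,1\<^esub>\<close>. With \<open>m = n - k + 1\<close> this places \<open>D\<^bsub>n,k\<^esub>\<close> between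
  \<open>v\<^bsub>n-k\<^esub>\<^sup>k\<^sup>-\<^sup>1 D\<^bsub>m,1\<^esub>\<close> and \<open>v\<^bsub>n-k\<^esub>\<^sup>k\<^sup>-\<^sup>1 D\<^bsub>m\<^esub>\<close>. The ratio \<open>r\<^sub>n = D\<^sub>n / D\<^bsub>n,1\<^esub>\<close> satisfies
  \<open>r\<^sub>n \<le> 1 + r\<^bsub>n-1\<^esub> / (n - 2)\<close>, so it tends to 1, and \<open>D\<^sub>n \<sim> v\<^bsub>n-1\<^esub> D\<^bsub>n-1\<^esub>\<close>; together with
  \<open>v\<^bsub>c+1\<^esub> = 1 + (c + 1) v\<^sub>c\<close> this gives the power of \<open>n\<close>.\<close>

subsection \<open>DOAGs as adjacency lists\<close>

text \<open>On lists without repetition this is a bijection onto the strict total orders of the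
  underlying finite set. Every order in a DOAG can thus be replaced by an increasing
  enumeration.\<close>

primrec list_order :: "'a list \<Rightarrow> ('a \<times> 'a) set" where
  "list_order [] = {}"
| "list_order (x # xs) = {x} \<times> set xs \<union> list_order xs"

lemma list_order_subset: "list_order xs \<subseteq> set xs \<times> set xs"
  by (induction xs) auto

lemma list_order_map: "list_order (map f xs) = map_prod f f ` list_order xs"
  by (induction xs) (auto simp: image_Un)

lemma strict_total_order_list_order:
  "distinct xs \<Longrightarrow> strict_total_order (set xs) (list_order xs)"
proof (induction xs)
  case Nil
  then show ?case
    by (auto simp: strict_total_order_def strict_linear_order_on_def trans_def irrefl_def total_on_def)
next
  case (Cons x xs)
  then show ?case
    unfolding strict_total_order_def strict_linear_order_on_def trans_def irrefl_def total_on_def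
    by (simp; blast)
qed

text \<open>The head is the least element, so the relation determines it. Dropping the pairs that
  start with the head leaves the relation of the tail.\<close>

lemma list_order_inject:
  "distinct xs \<Longrightarrow> distinct ys \<Longrightarrow> set xs = set ys \<Longrightarrow> list_order xs = list_order ys \<Longrightarrow> xs = ys"
proof (induction xs arbitrary: ys)
  case (Cons x xs)
  from Cons.prems(3) obtain y zs where ys: "ys = y # zs" by (cases ys) auto
  have "y = x"
  proof (rule ccontr)
    assume "y \<noteq> x"
    with Cons.prems(3) ys have "y \<in> set xs" by auto
    then have "(x, y) \<in> list_order ys" using Cons.prems(4) by (metis UnI1 SigmaI list_order.simps(2) singletonI)
    then show False using Cons.prems(2) ys list_order_subset[of zs] \<open>y \<noteq> x\<close> by auto
  qed
  have "set xs = set zs"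
    using Cons.prems(1-3) \<open>y = x\<close> unfolding ys by (metis distinct.simps(2) insert_ident list.simps(15))
  moreover have "list_order as = {p \<in> list_order (x # as). fst p \<noteq> x}" if "distinct (x # as)" for as
    using that list_order_subset[of as] by auto
  ultimately have "xs = zs"
    using Cons.IH[of zs] Cons.prems(1,2,4) ys \<open>y = x\<close> by (metis distinct.simps(2))
  with ys \<open>y = x\<close> show ?case by simp
qed simp

text \<open>A finite strict order is well-founded, so a nonempty carrier has a minimal element,
  which totality makes least. It becomes the head, and induction lists the rest.\<close>

lemma strict_total_order_imp_list:
  "finite A \<Longrightarrow> strict_total_order A r \<Longrightarrow> \<exists>xs. distinct xs \<and> set xs = A \<and> r = list_order xs"
proof (induction A arbitrary: r rule: finite_remove_induct)
  case empty
  then show ?case by (auto simp: strict_total_order_def)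
next
  case (remove A)
  have r: "r \<subseteq> A \<times> A" "trans r" "irrefl r" "total_on A r"
    using remove.prems unfolding strict_total_order_def strict_linear_order_on_def by auto
  have "finite r" using r(1) remove.hyps(1) by (meson finite_SigmaI finite_subset)
  moreover have "acyclic r" using r(2,3) by (simp add: acyclic_irrefl)
  ultimately have "wf r" by (rule finite_acyclic_wf)
  then obtain x where x: "x \<in> A" "\<And>y. (y, x) \<in> r \<Longrightarrow> y \<notin> A"
    using remove.hyps(2) unfolding wf_eq_minimal by (metis all_not_in_conv)
  let ?s = "r \<inter> (A - {x}) \<times> (A - {x})"
  have "strict_total_order (A - {x}) ?s"
    unfolding strict_total_order_def strict_linear_order_on_def
  proof (intro conjI)
    show "trans ?s" using r(2) unfolding trans_def by blast
    show "irrefl ?s" using r(3) unfolding irrefl_def by blast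
    show "total_on (A - {x}) ?s" using r(4) unfolding total_on_def by blast
  qed blast
  with remove.IH[OF x(1)] obtain xs where xs: "distinct xs" "set xs = A - {x}" "?s = list_order xs"
    by blast
  have "(x, y) \<in> r" if "y \<in> A" "y \<noteq> x" for y
    using that x r(4) unfolding total_on_def by blast
  then have "r = {x} \<times> (A - {x}) \<union> ?s"
    using r(1,3) x unfolding irrefl_def by blast
  then have "r = list_order (x # xs)" using xs by simp
  then show ?case using xs x(1) by (intro exI[of _ "x # xs"]) auto
qed

text \<open>A rank function witnesses acyclicity; it survives the insertion of a source more readily
  than \<^const>\<open>acyclic\<close> does.\<close>

definition adj_doag :: "'a set \<Rightarrow> ('a \<Rightarrow> 'a list) \<Rightarrow> 'a list \<Rightarrow> bool" where
  "adj_doag V N S \<longleftrightarrow> finite V \<and> (\<forall>v\<in>V. distinct (N v) \<and> set (N v) \<subseteq> V) \<and>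
     (\<exists>\<rho> :: 'a \<Rightarrow> nat. \<forall>v\<in>V. \<forall>w\<in>set (N v). \<rho> v < \<rho> w) \<and>
     distinct S \<and> set S = {v \<in> V. \<forall>u\<in>V. v \<notin> set (N u)}"

definition doag_of :: "'a set \<Rightarrow> ('a \<Rightarrow> 'a list) \<Rightarrow> 'a list \<Rightarrow> 'a doag" where
  "doag_of V N S = \<lparr>verts = V, edges = {(v, w). v \<in> V \<and> w \<in> set (N v)},
     out_ord = (\<lambda>v. if v \<in> V then list_order (map (Pair v) (N v)) else {}),
     src_ord = list_order S\<rparr>"

definition adj_iso ::
  "('a \<Rightarrow> 'b) \<Rightarrow> 'a set \<Rightarrow> ('a \<Rightarrow> 'a list) \<Rightarrow> 'a list \<Rightarrow> 'b set \<Rightarrow> ('b \<Rightarrow> 'b list) \<Rightarrow> 'b list \<Rightarrow> bool" where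
  "adj_iso f V N S V' N' S' \<longleftrightarrow>
     bij_betw f V V' \<and> (\<forall>v\<in>V. N' (f v) = map f (N v)) \<and> S' = map f S"

lemma verts_doag_of [simp]: "verts (doag_of V N S) = V"
  by (simp add: doag_of_def)

lemma sources_doag_of: "adj_doag V N S \<Longrightarrow> sources (doag_of V N S) = set S"
  by (auto simp: adj_doag_def doag_of_def sources_def)

lemma out_edges_doag_of: "v \<in> V \<Longrightarrow> out_edges (doag_of V N S) v = set (map (Pair v) (N v))"
  by (auto simp: doag_of_def out_edges_def)

lemma is_doag_doag_of:
  assumes "adj_doag V N S"
  shows "is_doag (doag_of V N S)"
proof -
  let ?G = "doag_of V N S"
  obtain \<rho> :: "'a \<Rightarrow> nat" where \<rho>: "\<And>v w. v \<in> V \<Longrightarrow> w \<in> set (N v) \<Longrightarrow> \<rho> v < \<rho> w"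
    using assms unfolding adj_doag_def by blast
  have "edges ?G \<subseteq> measure \<rho>" using \<rho> by (auto simp: doag_of_def)
  then have "acyclic (edges ?G)" using wf_acyclic wf_measure wf_subset by blast
  moreover have "strict_total_order (out_edges ?G v) (out_ord ?G v)" if "v \<in> V" for v
  proof -
    have "distinct (map (Pair v) (N v))"
      using assms that by (auto simp: adj_doag_def distinct_map inj_on_def)
    then show ?thesis
      unfolding out_edges_doag_of[OF that]
      using strict_total_order_list_order that by (fastforce simp: doag_of_def)
  qed
  moreover have "strict_total_order (sources ?G) (src_ord ?G)"
    unfolding sources_doag_of[OF assms]
    using strict_total_order_list_order[of S] assms by (simp add: doag_of_def adj_doag_def)
  moreover have "edges ?G \<subseteq> V \<times> V" "finite V"
    using assms by (auto simp: adj_doag_def doag_of_def)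
  moreover have "\<forall>v. v \<notin> V \<longrightarrow> out_ord ?G v = {}" by (simp add: doag_of_def)
  ultimately show ?thesis unfolding is_doag_def by simp
qed

lemma is_doag_imp_adj:
  assumes "is_doag G"
  shows "\<exists>N S. adj_doag (verts G) N S \<and> G = doag_of (verts G) N S"
proof -
  have fin: "finite (verts G)" and E: "edges G \<subseteq> verts G \<times> verts G" and ac: "acyclic (edges G)"
    using assms unfolding is_doag_def by auto
  have finE: "finite (edges G)" using fin E by (meson finite_SigmaI finite_subset)
  \<comment> \<open>The rank is the number of proper ancestors. Along an edge from \<open>v\<close>
    to \<open>w\<close> it grows strictly, since \<open>w\<close> inherits the ancestors of
    \<open>v\<close> and gains \<open>v\<close> itself, which acyclicity keeps from being its own
    ancestor.\<close>
  define \<rho> where "\<rho> v = card {u. (u, v) \<in> (edges G)\<^sup>+}" for v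
  have \<rho>: "\<rho> v < \<rho> w" if "(v, w) \<in> edges G" for v w
    unfolding \<rho>_def
  proof (rule psubset_card_mono)
    have "{u. (u, w) \<in> (edges G)\<^sup>+} \<subseteq> fst ` (edges G)\<^sup>+" by force
    then show "finite {u. (u, w) \<in> (edges G)\<^sup>+}"
      using finE by (meson finite_imageI finite_subset finite_trancl)
    show "{u. (u, v) \<in> (edges G)\<^sup>+} \<subset> {u. (u, w) \<in> (edges G)\<^sup>+}"
      using that ac unfolding acyclic_def by (auto intro: trancl_into_trancl)
  qed
  have "\<exists>ws. distinct ws \<and> set ws = {w. (v, w) \<in> edges G} \<and> out_ord G v = list_order (map (Pair v) ws)"
    if v: "v \<in> verts G" for v
  proof -
    have "finite (out_edges G v)" using finE unfolding out_edges_def by auto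
    moreover have "strict_total_order (out_edges G v) (out_ord G v)"
      using assms v unfolding is_doag_def by blast
    ultimately obtain es where es: "distinct es" "set es = out_edges G v" "out_ord G v = list_order es"
      using strict_total_order_imp_list by blast
    have *: "map (Pair v) (map snd es) = es"
      using es(2) by (auto simp: out_edges_def intro!: map_idI)
    have "set (map snd es) = {w. (v, w) \<in> edges G}"
      using es(2) by (force simp: out_edges_def)
    then show ?thesis using es * by (metis distinct_map)
  qed
  then obtain N where N: "\<And>v. v \<in> verts G \<Longrightarrow> distinct (N v) \<and> set (N v) = {w. (v, w) \<in> edges G}
      \<and> out_ord G v = list_order (map (Pair v) (N v))" by metis
  have "finite (sources G)" using fin unfolding sources_def by auto
  then obtain S where S: "distinct S" "set S = sources G" "src_ord G = list_order S"
    using strict_total_order_imp_list assms unfolding is_doag_def by metis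
  have "adj_doag (verts G) N S"
    unfolding adj_doag_def
  proof (intro conjI)
    show "\<exists>\<rho> :: 'a \<Rightarrow> nat. \<forall>v\<in>verts G. \<forall>w\<in>set (N v). \<rho> v < \<rho> w"
      using \<rho> N by (intro exI[of _ \<rho>]) auto
    show "set S = {v \<in> verts G. \<forall>u\<in>verts G. v \<notin> set (N u)}"
      using S(2) N E by (auto simp: sources_def)
  qed (use fin N E S in auto)
  moreover have "G = doag_of (verts G) N S"
  proof (rule doag.equality)
    show "edges G = edges (doag_of (verts G) N S)" using E N by (auto simp: doag_of_def)
    show "out_ord G = out_ord (doag_of (verts G) N S)"
      using assms N unfolding is_doag_def doag_of_def by (auto simp: fun_eq_iff)
  qed (use S in \<open>simp_all add: doag_of_def\<close>)
  ultimately show ?thesis by blast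
qed

lemma map_prod_image_eq:
  assumes "R \<subseteq> A \<times> A" "R' \<subseteq> f ` A \<times> f ` A"
    and "\<forall>x\<in>A. \<forall>y\<in>A. (x, y) \<in> R \<longleftrightarrow> (f x, f y) \<in> R'"
  shows "R' = map_prod f f ` R"
proof (intro equalityI subsetI)
  fix p assume p: "p \<in> R'"
  then obtain x y where "p = (f x, f y)" "x \<in> A" "y \<in> A" using assms(2) by blast
  with p assms(3) have "(x, y) \<in> R" by simp
  with \<open>p = (f x, f y)\<close> show "p \<in> map_prod f f ` R" by (simp add: rev_image_eqI)
next
  fix p assume "p \<in> map_prod f f ` R"
  then obtain x y where "p = (f x, f y)" "(x, y) \<in> R" by auto
  with assms(1,3) show "p \<in> R'" by blast
qed

lemma map_prod_image_mem:
  assumes "inj_on f A" "R \<subseteq> A \<times> A" "x \<in> A" "y \<in> A"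
  shows "(f x, f y) \<in> map_prod f f ` R \<longleftrightarrow> (x, y) \<in> R"
proof
  assume "(f x, f y) \<in> map_prod f f ` R"
  then obtain a b where ab: "f x = f a" "f y = f b" "(a, b) \<in> R" by auto
  with assms(2) have "a \<in> A" "b \<in> A" by auto
  with ab assms(1,3,4) show "(x, y) \<in> R" by (metis inj_onD)
qed (simp add: rev_image_eqI)

text \<open>An isomorphism of finite total orders carries the increasing enumeration to the
  increasing enumeration. Preservation of edges and of all orders therefore collapses to equations
  between lists.\<close>

lemma doag_iso_doag_of:
  assumes G: "adj_doag V N S" and H: "adj_doag V' N' S'"
  shows "doag_iso f (doag_of V N S) (doag_of V' N' S') \<longleftrightarrow> adj_iso f V N S V' N' S'"
proof
  let ?G = "doag_of V N S" and ?H = "doag_of V' N' S'"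
  assume iso: "doag_iso f ?G ?H"
  then have bij: "bij_betw f V V'" unfolding doag_iso_def by simp
  then have inj: "inj_on f V" and im: "f ` V = V'" by (auto simp: bij_betw_def)
  have dS: "distinct S" "distinct S'" "set S \<subseteq> V" using G H by (auto simp: adj_doag_def)
  have imS: "set S' = f ` set S"
    using doag_iso_sources[OF is_doag_doag_of[OF G] is_doag_doag_of[OF H] iso]
    unfolding sources_doag_of[OF G] sources_doag_of[OF H] by (simp add: bij_betw_def)
  have "list_order S' = map_prod f f ` list_order S"
  proof (rule map_prod_image_eq)
    show "list_order S' \<subseteq> f ` set S \<times> f ` set S" using list_order_subset imS by metis
    show "\<forall>x\<in>set S. \<forall>y\<in>set S. (x, y) \<in> list_order S \<longleftrightarrow> (f x, f y) \<in> list_order S'"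
      using iso unfolding doag_iso_def sources_doag_of[OF G] by (simp add: doag_of_def)
  qed (rule list_order_subset)
  then have "S' = map f S"
    using dS imS inj by (intro list_order_inject)
      (auto simp: distinct_map list_order_map intro: inj_on_subset)
  moreover have "N' (f v) = map f (N v)" if v: "v \<in> V" for v
  proof -
    have fv: "f v \<in> V'" using v im by blast
    have Nv: "set (N v) \<subseteq> V" "distinct (N v)" "set (N' (f v)) \<subseteq> V'" "distinct (N' (f v))"
      using v fv G H by (auto simp: adj_doag_def)
    have "w \<in> set (N v) \<longleftrightarrow> f w \<in> set (N' (f v))" if "w \<in> V" for w
      using iso v fv that unfolding doag_iso_def by (auto simp: doag_of_def)
    then have imN: "set (N' (f v)) = f ` set (N v)" using Nv im by blast
    let ?E = "map (Pair v) (N v)" and ?E' = "map (Pair (f v)) (N' (f v))"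
    have ord: "out_ord ?G v = list_order ?E" "out_ord ?H (f v) = list_order ?E'"
      using v fv by (simp_all add: doag_of_def)
    have iso_ord: "\<forall>d\<in>out_edges ?G v. \<forall>e\<in>out_edges ?G v.
        (d, e) \<in> out_ord ?G v \<longleftrightarrow> (map_prod f f d, map_prod f f e) \<in> out_ord ?H (f v)"
      using iso v unfolding doag_iso_def verts_doag_of by blast
    have sE: "set ?E' = map_prod f f ` set ?E" using imN by force
    have "list_order ?E' = map_prod (map_prod f f) (map_prod f f) ` list_order ?E"
    proof (rule map_prod_image_eq)
      show "list_order ?E' \<subseteq> map_prod f f ` set ?E \<times> map_prod f f ` set ?E"
        using list_order_subset sE by metis
      show "\<forall>x\<in>set ?E. \<forall>y\<in>set ?E. (x, y) \<in> list_order ?E \<longleftrightarrow>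
          (map_prod f f x, map_prod f f y) \<in> list_order ?E'"
        using iso_ord unfolding out_edges_doag_of[OF v] ord .
    qed (rule list_order_subset)
    also have "\<dots> = list_order (map (Pair (f v)) (map f (N v)))"
      by (simp add: list_order_map[symmetric] comp_def)
    finally have "?E' = map (Pair (f v)) (map f (N v))"
      using Nv inj_on_subset[OF inj Nv(1)] imN
      by (intro list_order_inject) (auto simp: distinct_map inj_on_def[of "Pair _"] simp del: map_map)
    from arg_cong[OF this, of "map snd"] show ?thesis by (simp add: comp_def)
  qed
  ultimately show "adj_iso f V N S V' N' S'" using bij by (simp add: adj_iso_def)
next
  let ?G = "doag_of V N S" and ?H = "doag_of V' N' S'"
  assume "adj_iso f V N S V' N' S'"
  then have bij: "bij_betw f V V'" and N: "\<And>v. v \<in> V \<Longrightarrow> N' (f v) = map f (N v)" and S: "S' = map f S"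
    by (auto simp: adj_iso_def)
  then have inj: "inj_on f V" and fV: "\<And>v. v \<in> V \<Longrightarrow> f v \<in> V'" by (auto simp: bij_betw_def)
  have NV: "set (N v) \<subseteq> V" if "v \<in> V" for v using G that by (auto simp: adj_doag_def)
  show "doag_iso f ?G ?H"
    unfolding doag_iso_def
  proof (intro conjI ballI)
    show "bij_betw f (verts ?G) (verts ?H)" using bij by simp
  next
    fix u v assume "u \<in> verts ?G" "v \<in> verts ?G"
    then have "u \<in> V" "v \<in> V" by auto
    moreover have "f v \<in> f ` set (N u) \<longleftrightarrow> v \<in> set (N u)"
      using inj_on_image_mem_iff[OF inj \<open>v \<in> V\<close> NV[OF \<open>u \<in> V\<close>]] .
    ultimately show "(u, v) \<in> edges ?G \<longleftrightarrow> (f u, f v) \<in> edges ?H"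
      using fV N by (simp add: doag_of_def)
  next
    fix v d e assume a: "v \<in> verts ?G" and de: "d \<in> out_edges ?G v" "e \<in> out_edges ?G v"
    from a have v: "v \<in> V" by simp
    let ?E = "map (Pair v) (N v)"
    have "inj_on (map_prod f f) (set ?E)"
      using inj NV[OF v] v by (auto simp: inj_on_def)
    then have "(map_prod f f d, map_prod f f e) \<in> map_prod (map_prod f f) (map_prod f f) ` list_order ?E
        \<longleftrightarrow> (d, e) \<in> list_order ?E"
      by (rule map_prod_image_mem[OF _ list_order_subset]) (use de out_edges_doag_of[OF v] in auto)
    moreover have "map_prod (map_prod f f) (map_prod f f) ` list_order ?E
        = list_order (map (Pair (f v)) (N' (f v)))"
      by (simp add: list_order_map[symmetric] comp_def N[OF v])
    ultimately show "(d, e) \<in> out_ord ?G v \<longleftrightarrow> (map_prod f f d, map_prod f f e) \<in> out_ord ?H (f v)"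
      using v fV by (simp add: doag_of_def)
  next
    fix s t assume "s \<in> sources ?G" "t \<in> sources ?G"
    then have st: "s \<in> set S" "t \<in> set S" unfolding sources_doag_of[OF G] by auto
    have "inj_on f (set S)" using inj G by (auto simp: adj_doag_def intro: inj_on_subset)
    from map_prod_image_mem[OF this list_order_subset st]
    show "(s, t) \<in> src_ord ?G \<longleftrightarrow> (f s, f t) \<in> src_ord ?H"
      by (simp add: doag_of_def S list_order_map)
  qed
qed

subsection \<open>Isomorphism classes\<close>

text \<open>Rigidity: the order of the sources forces the values on sources, and any other vertex is
  a member of the list of a predecessor of smaller rank, whose image is already forced. In
  particular a DOAG has no nontrivial automorphism.\<close>

lemma adj_iso_unique:
  assumes "adj_doag V N S" "adj_iso f V N S V' N' S'" "adj_iso g V N S V' N' S'" "v \<in> V"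
  shows "f v = g v"
proof -
  obtain \<rho> :: "'a \<Rightarrow> nat" where \<rho>: "\<And>v w. v \<in> V \<Longrightarrow> w \<in> set (N v) \<Longrightarrow> \<rho> v < \<rho> w"
    using assms(1) unfolding adj_doag_def by blast
  show ?thesis
    using assms(4)
  proof (induction "\<rho> v" arbitrary: v rule: less_induct)
    case less
    show ?case
    proof (cases "v \<in> set S")
      case True
      have "map f S = map g S" using assms(2,3) by (simp add: adj_iso_def)
      then show ?thesis using True by simp
    next
      case False
      then obtain u where u: "u \<in> V" "v \<in> set (N u)"
        using assms(1) less.prems unfolding adj_doag_def by blast
      then have "f u = g u" using less.hyps \<rho> by blast
      then have "map f (N u) = map g (N u)" using assms(2,3) u(1) unfolding adj_iso_def by metis
      then show ?thesis using u(2) by simp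
    qed
  qed
qed

text \<open>Transport of structure, the rank function being pulled back along the inverse bijection.
  The target is not known to be a DOAG beforehand, so this serves to construct normal forms.\<close>

lemma adj_iso_image:
  assumes "adj_doag V N S" "bij_betw f V V'" "\<And>v. v \<in> V \<Longrightarrow> N' (f v) = map f (N v)"
  shows "adj_doag V' N' (map f S)"
  unfolding adj_doag_def
proof (intro conjI ballI)
  have inj: "inj_on f V" and im: "f ` V = V'" using assms(2) by (auto simp: bij_betw_def)
  have NV: "distinct (N v)" "set (N v) \<subseteq> V" if "v \<in> V" for v
    using assms(1) that by (auto simp: adj_doag_def)
  have S: "distinct S" "set S = {v \<in> V. \<forall>u\<in>V. v \<notin> set (N u)}"
    using assms(1) by (auto simp: adj_doag_def)
  show "finite V'" using assms(1) im by (auto simp: adj_doag_def)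
  show "distinct (map f S)" using S inj by (auto simp: distinct_map intro: inj_on_subset)
  have mem: "f v \<in> set (N' (f u)) \<longleftrightarrow> v \<in> set (N u)" if "u \<in> V" "v \<in> V" for u v
    using inj_on_image_mem_iff[OF inj that(2) NV(2)[OF that(1)]] assms(3)[OF that(1)] by simp
  show "set (map f S) = {v \<in> V'. \<forall>u\<in>V'. v \<notin> set (N' u)}"
    unfolding set_map S(2) im[symmetric] using mem by blast
  obtain \<rho> :: "'a \<Rightarrow> nat" where \<rho>: "\<And>v w. v \<in> V \<Longrightarrow> w \<in> set (N v) \<Longrightarrow> \<rho> v < \<rho> w"
    using assms(1) unfolding adj_doag_def by blast
  show "\<exists>\<rho>::'b \<Rightarrow> nat. \<forall>v\<in>V'. \<forall>w\<in>set (N' v). \<rho> v < \<rho> w"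
  proof (intro exI ballI)
    fix v w assume "v \<in> V'" "w \<in> set (N' v)"
    then obtain a where a: "a \<in> V" "v = f a" using im by blast
    with \<open>w \<in> set (N' v)\<close> assms(3) obtain b where b: "b \<in> set (N a)" "w = f b" by auto
    with NV(2) a have "b \<in> V" by blast
    then show "(\<rho> \<circ> inv_into V f) v < (\<rho> \<circ> inv_into V f) w"
      using a b \<rho> inj by simp
  qed
next
  fix w assume "w \<in> V'"
  then obtain v where v: "v \<in> V" "w = f v" using assms(2) by (auto simp: bij_betw_def)
  then have "distinct (N v)" "set (N v) \<subseteq> V" using assms(1) by (auto simp: adj_doag_def)
  moreover have "inj_on f V" "f ` V = V'" using assms(2) by (auto simp: bij_betw_def)
  ultimately show "distinct (N' w)" "set (N' w) \<subseteq> V'"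
    using assms(3)[OF v(1)] v(2) by (auto simp: distinct_map intro: inj_on_subset)
qed

text \<open>Numbering the vertices with the sources first, in their order, turns the list of sources
  into an initial segment. A normal form is then described by two numbers and a neighbour
  function.\<close>

lemma adj_doag_normalize:
  assumes "adj_doag V N S"
  shows "\<exists>f M. adj_doag {..<card V} M [0..<length S] \<and> adj_iso f V N S {..<card V} M [0..<length S]"
proof -
  have "finite V" "distinct S" "set S \<subseteq> V" using assms by (auto simp: adj_doag_def)
  obtain ts where ts: "set ts = V - set S" "distinct ts"
    using finite_distinct_list \<open>finite V\<close> by (metis finite_Diff)
  define xs where "xs = S @ ts"
  have xs: "distinct xs" "set xs = V"
    using ts \<open>distinct S\<close> \<open>set S \<subseteq> V\<close> unfolding xs_def by auto
  have "length xs = card V" using distinct_card[OF xs(1)] xs(2) by simp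
  note xs = xs this
  define f where "f = inv_into {..<card V} (\<lambda>i. xs ! i)"
  have bx: "bij_betw (\<lambda>i. xs ! i) {..<card V} V"
    using xs by (metis bij_betw_nth)
  then have bf: "bij_betw f V {..<card V}" unfolding f_def by (rule bij_betw_inv_into)
  have fx: "f (xs ! i) = i" if "i < card V" for i
    unfolding f_def using bx that by (simp add: bij_betw_inv_into_left)
  have xf: "xs ! f v = v" if "v \<in> V" for v
    unfolding f_def using bij_betw_inv_into_right[OF bx that] .
  have "map f S = [0..<length S]"
  proof (rule nth_equalityI)
    fix i assume "i < length (map f S)"
    then have "i < length S" "S ! i = xs ! i" "i < card V"
      using xs(3) by (auto simp: xs_def nth_append)
    then show "map f S ! i = [0..<length S] ! i" using fx by simp
  qed simp
  moreover define M where "M i = map f (N (xs ! i))" for i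
  have M: "M (f v) = map f (N v)" if "v \<in> V" for v unfolding M_def using xf that by simp
  ultimately have "adj_iso f V N S {..<card V} M [0..<length S]"
    using bf by (simp add: adj_iso_def)
  moreover have "adj_doag {..<card V} M [0..<length S]"
    using adj_iso_image[OF assms bf, of M] M \<open>map f S = [0..<length S]\<close> by simp
  ultimately show ?thesis by blast
qed

section \<open>Classes with prescribed numbers of sources, and their representatives\<close>

definition dclass :: "nat set \<Rightarrow> (nat \<Rightarrow> nat list) \<Rightarrow> nat list \<Rightarrow> nat doag set" where
  "dclass V N S = doag_equiv `` {doag_of V N S}"

lemma dclass_eq_iff:
  assumes "adj_doag V N S" "adj_doag V' N' S'"
  shows "dclass V N S = dclass V' N' S' \<longleftrightarrow> (\<exists>f. adj_iso f V N S V' N' S')"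
proof -
  have "dclass V N S = dclass V' N' S' \<longleftrightarrow> (doag_of V N S, doag_of V' N' S') \<in> doag_equiv"
    unfolding dclass_def
    using eq_equiv_class_iff[OF equiv_doag] is_doag_doag_of[OF assms(1)] is_doag_doag_of[OF assms(2)]
    by simp
  also have "\<dots> \<longleftrightarrow> (\<exists>f. adj_iso f V N S V' N' S')"
    using is_doag_doag_of[OF assms(1)] is_doag_doag_of[OF assms(2)] doag_iso_doag_of[OF assms]
    by (simp add: doag_equiv_def)
  finally show ?thesis .
qed

text \<open>A set of admissible source numbers treats exactly \<open>k\<close>, at least
  \<open>k\<close> and arbitrarily many sources uniformly.\<close>

definition doag_classes :: "nat \<Rightarrow> nat set \<Rightarrow> nat doag set set" where
  "doag_classes n K = {G. is_doag G \<and> card (verts G) = n \<and> card (sources G) \<in> K} // doag_equiv"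

definition doag_rep :: "nat doag set \<Rightarrow> nat \<Rightarrow> nat \<Rightarrow> (nat \<Rightarrow> nat list) \<Rightarrow> bool" where
  "doag_rep X n p N \<longleftrightarrow> adj_doag {..<n} N [0..<p] \<and> X = dclass {..<n} N [0..<p]"

lemma dclass_in_classes:
  assumes "adj_doag V N S" "card V = n" "length S \<in> K"
  shows "dclass V N S \<in> doag_classes n K"
proof -
  have "card (sources (doag_of V N S)) = length S"
    using assms(1) sources_doag_of[OF assms(1)] distinct_card unfolding adj_doag_def by metis
  then show ?thesis
    unfolding doag_classes_def dclass_def
    using assms is_doag_doag_of[OF assms(1)] by (intro quotientI) auto
qed

lemma doag_classes_adj:
  assumes "X \<in> doag_classes n K"
  obtains V N S where "adj_doag V N S" "card V = n" "length S \<in> K" "X = dclass V N S"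
proof -
  obtain G where G: "is_doag G" "card (verts G) = n" "card (sources G) \<in> K" "X = doag_equiv `` {G}"
    using assms unfolding doag_classes_def by (auto elim: quotientE)
  obtain N S where NS: "adj_doag (verts G) N S" "G = doag_of (verts G) N S"
    using is_doag_imp_adj[OF G(1)] by blast
  have "length S = card (sources G)"
    using NS(1) sources_doag_of[OF NS(1)] NS(2) distinct_card unfolding adj_doag_def by metis
  then show ?thesis using that[OF NS(1) G(2)] G(3,4) NS(2) by (simp add: dclass_def)
qed

lemma doag_classes_rep:
  assumes "X \<in> doag_classes n K"
  obtains N p where "doag_rep X n p N" "p \<in> K"
proof -
  obtain V N S where *: "adj_doag V N S" "card V = n" "length S \<in> K" "X = dclass V N S"
    using doag_classes_adj[OF assms] .
  obtain f M where "adj_doag {..<n} M [0..<length S]" "adj_iso f V N S {..<n} M [0..<length S]"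
    using adj_doag_normalize[OF *(1)] *(2) by blast
  then have "doag_rep X n (length S) M"
    unfolding doag_rep_def *(4) using dclass_eq_iff[OF *(1)] by blast
  then show ?thesis using that *(3) by blast
qed

lemma sources_le_verts: "adj_doag {..<n} N [0..<p] \<Longrightarrow> p \<le> n"
proof -
  assume "adj_doag {..<n} N [0..<p]"
  then have "set [0..<p] \<subseteq> {..<n}" unfolding adj_doag_def by blast
  then have "card (set [0..<p]) \<le> card {..<n}" by (rule card_mono[rotated]) simp
  then show "p \<le> n" by simp
qed

lemma doag_rep_unique:
  assumes "doag_rep X n p N" "doag_rep X m q M"
  shows "n = m" "p = q"
proof -
  have "\<exists>f. adj_iso f {..<n} N [0..<p] {..<m} M [0..<q]"
    using assms dclass_eq_iff unfolding doag_rep_def by metis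
  then obtain f where f: "bij_betw f {..<n} {..<m}" "[0..<q] = map f [0..<p]"
    unfolding adj_iso_def by blast
  from bij_betw_same_card[OF f(1)] show "n = m" by simp
  from arg_cong[OF f(2), of length] show "p = q" by simp
qed

lemma finite_doag_classes: "finite (doag_classes n K)"
  unfolding doag_classes_def
  by (rule finite_subset[OF _ finite_doags[of n]]) (auto simp: quotient_def)

lemma num_doags_src_eq: "num_doags_src n k = card (doag_classes n {k})"
  unfolding num_doags_src_def doag_classes_def by simp

lemma num_doags_eq: "num_doags n = card (doag_classes n UNIV)"
  unfolding num_doags_def doag_classes_def by simp

lemma doag_classes_mono: "K \<subseteq> L \<Longrightarrow> doag_classes n K \<subseteq> doag_classes n L"
  unfolding doag_classes_def quotient_def by auto

lemma doag_classes_Un: "doag_classes n (K \<union> L) = doag_classes n K \<union> doag_classes n L"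
  unfolding doag_classes_def quotient_def by auto

lemma doag_classes_disjoint:
  assumes "K \<inter> L = {}"
  shows "doag_classes n K \<inter> doag_classes n L = {}"
proof (rule ccontr)
  assume "\<not> ?thesis"
  then obtain X where X: "X \<in> doag_classes n K" "X \<in> doag_classes n L" by blast
  obtain N p where "doag_rep X n p N" "p \<in> K" using doag_classes_rep[OF X(1)] .
  moreover obtain M q where "doag_rep X n q M" "q \<in> L" using doag_classes_rep[OF X(2)] .
  ultimately show False using doag_rep_unique assms by blast
qed

text \<open>A vertex of least rank has no predecessor.\<close>

lemma adj_doag_sources_nonempty:
  assumes "adj_doag V N S" "V \<noteq> {}"
  shows "S \<noteq> []"
proof -
  obtain \<rho> :: "'a \<Rightarrow> nat" where \<rho>: "\<And>v w. v \<in> V \<Longrightarrow> w \<in> set (N v) \<Longrightarrow> \<rho> v < \<rho> w"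
    using assms(1) unfolding adj_doag_def by blast
  obtain v where v: "v \<in> V" "\<And>u. u \<in> V \<Longrightarrow> \<rho> v \<le> \<rho> u"
    using assms(2) ex_has_least_nat[of "\<lambda>v. v \<in> V" _ \<rho>] by blast
  then have "v \<notin> set (N u)" if "u \<in> V" for u using \<rho> that leD by blast
  then have "v \<in> set S" using assms(1) v(1) unfolding adj_doag_def by blast
  then show ?thesis by auto
qed

lemma doag_classes_nonzero_sources:
  assumes "0 < n"
  shows "doag_classes n UNIV = doag_classes n {1..}"
proof (intro equalityI subsetI)
  fix X assume "X \<in> doag_classes n UNIV"
  then obtain V N S where *: "adj_doag V N S" "card V = n" "length S \<in> UNIV" "X = dclass V N S"
    by (rule doag_classes_adj)
  then have "S \<noteq> []" using adj_doag_sources_nonempty assms by fastforce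
  then have "length S \<in> {1..}" by (cases S) auto
  with * show "X \<in> doag_classes n {1..}" using dclass_in_classes by blast
qed (use doag_classes_mono in blast)

section \<open>Inserting and deleting the smallest source\<close>

definition source_cons :: "nat \<Rightarrow> nat list \<Rightarrow> nat \<Rightarrow> nat list" where
  "source_cons n l p = n # filter (\<lambda>x. x \<notin> set l) [0..<p]"

text \<open>The new vertex \<open>n\<close>, with out-neighbours \<open>l\<close>, becomes the first
  source; old sources occurring in \<open>l\<close> are covered and drop out, and the others keep
  their order.\<close>

lemma adj_doag_source_cons:
  assumes "adj_doag {..<n} N [0..<p]" "distinct l" "set l \<subseteq> {..<n}"
  shows "adj_doag {..<Suc n} (N(n := l)) (source_cons n l p)"
  unfolding adj_doag_def
proof (intro conjI ballI)
  have NV: "set (N v) \<subseteq> {..<n}" if "v < n" for v using assms(1) that by (auto simp: adj_doag_def)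
  have S: "set [0..<p] = {v \<in> {..<n}. \<forall>u\<in>{..<n}. v \<notin> set (N u)}"
    using assms(1) by (simp only: adj_doag_def)
  have "p \<le> n" using sources_le_verts[OF assms(1)] .
  then show "distinct (source_cons n l p)" by (auto simp: source_cons_def)
  obtain \<rho> :: "nat \<Rightarrow> nat" where \<rho>: "\<And>v w. v < n \<Longrightarrow> w \<in> set (N v) \<Longrightarrow> \<rho> v < \<rho> w"
    using assms(1) unfolding adj_doag_def by blast
  show "\<exists>\<rho>::nat \<Rightarrow> nat. \<forall>v\<in>{..<Suc n}. \<forall>w\<in>set ((N(n := l)) v). \<rho> v < \<rho> w"
  proof (intro exI ballI)
    fix v w assume "v \<in> {..<Suc n}" "w \<in> set ((N(n := l)) v)"
    \<comment> \<open>Old ranks move up by one, which frees rank 0 for the new source.\<close>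
    then show "((Suc \<circ> \<rho>)(n := 0)) v < ((Suc \<circ> \<rho>)(n := 0)) w"
      using assms(3) \<rho>[of v w] NV[of v] by (cases "v = n") auto
  qed
  show "set (source_cons n l p) = {v \<in> {..<Suc n}. \<forall>u\<in>{..<Suc n}. v \<notin> set ((N(n := l)) u)}"
  proof (intro set_eqI)
    fix x
    have "n \<notin> set (N u)" if "u < n" for u using NV[OF that] by blast
    moreover have "x \<in> set [0..<p] \<longleftrightarrow> x < n \<and> (\<forall>u<n. x \<notin> set (N u))"
      unfolding S by blast
    ultimately show "x \<in> set (source_cons n l p) \<longleftrightarrow>
        x \<in> {v \<in> {..<Suc n}. \<forall>u\<in>{..<Suc n}. v \<notin> set ((N(n := l)) u)}"
      using assms(3) by (cases "x = n") (auto simp: source_cons_def less_Suc_eq)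
  qed
next
  fix v assume "v \<in> {..<Suc n}"
  then have "v = n \<or> distinct (N v) \<and> set (N v) \<subseteq> {..<n}"
    using assms(1) by (auto simp: adj_doag_def less_Suc_eq)
  then show "distinct ((N(n := l)) v)" "set ((N(n := l)) v) \<subseteq> {..<Suc n}"
    using assms(2,3) by auto
qed simp

text \<open>The vertices uncovered by deleting \<open>v\<close> are the out-neighbours of
  \<open>v\<close> without another predecessor. They are appended in the order in which
  \<open>v\<close> lists them, behind the old sources.\<close>

lemma adj_doag_remove_source:
  assumes "adj_doag V N (v # S)"
  shows "adj_doag (V - {v}) N (S @ filter (\<lambda>w. \<forall>u\<in>V - {v}. w \<notin> set (N u)) (N v))"
    (is "adj_doag ?V N (S @ ?T)")
  unfolding adj_doag_def
proof (intro conjI ballI)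
  have S: "insert v (set S) = {v \<in> V. \<forall>u\<in>V. v \<notin> set (N u)}" "distinct (v # S)"
    using assms by (simp_all add: adj_doag_def)
  have v: "v \<in> V" "\<And>u. u \<in> V \<Longrightarrow> v \<notin> set (N u)" using S(1) by blast+
  have NV: "distinct (N u)" "set (N u) \<subseteq> V" if "u \<in> V" for u
    using assms that by (auto simp: adj_doag_def)
  show "finite ?V" using assms by (auto simp: adj_doag_def)
  show "\<exists>\<rho>::'a \<Rightarrow> nat. \<forall>v\<in>?V. \<forall>w\<in>set (N v). \<rho> v < \<rho> w"
    using assms unfolding adj_doag_def by blast
  have "set S \<inter> set (N v) = {}" using S(1) v by blast
  then show "distinct (S @ ?T)" using S(2) NV v(1) by auto
  have "set S = {w \<in> ?V. \<forall>u\<in>V. w \<notin> set (N u)}" using S by auto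
  then show "set (S @ ?T) = {w \<in> ?V. \<forall>u\<in>?V. w \<notin> set (N u)}"
    using v NV[OF v(1)] by auto
  fix u assume "u \<in> ?V"
  then show "distinct (N u)" "set (N u) \<subseteq> ?V" using NV v by auto
qed

text \<open>Insertion undoes deletion: the uncovered sources all lie in the word and are filtered
  out again, whereas no old source is an out-neighbour of \<open>v\<close>, so all of these
  remain.\<close>

lemma adj_iso_source_cons:
  assumes "adj_doag V N (v # S)"
    and "adj_iso f (V - {v}) N (S @ filter (\<lambda>w. \<forall>u\<in>V - {v}. w \<notin> set (N u)) (N v)) {..<n} M [0..<p]"
  shows "adj_iso (f(v := n)) V N (v # S) {..<Suc n} (M(n := map f (N v))) (source_cons n (map f (N v)) p)"
proof -
  let ?g = "f(v := n)" and ?T = "filter (\<lambda>w. \<forall>u\<in>V - {v}. w \<notin> set (N u)) (N v)"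
  have f: "bij_betw f (V - {v}) {..<n}" "\<And>u. u \<in> V - {v} \<Longrightarrow> M (f u) = map f (N u)"
      "[0..<p] = map f S @ map f ?T"
    using assms(2) unfolding adj_iso_def by auto
  have S: "insert v (set S) = {v \<in> V. \<forall>u\<in>V. v \<notin> set (N u)}" "distinct (v # S)"
    using assms by (simp_all add: adj_doag_def)
  have v: "v \<in> V" "\<And>u. u \<in> V \<Longrightarrow> v \<notin> set (N u)" using S(1) by blast+
  have NV: "set (N u) \<subseteq> V - {v}" if "u \<in> V" for u
    using assms(1) that v by (auto simp: adj_doag_def)
  have gN: "map ?g (N u) = map f (N u)" if "u \<in> V" for u using v that by auto
  have SV: "set S \<subseteq> V - {v}" "set S \<inter> set (N v) = {}" using S v by auto
  have "bij_betw ?g (V - {v}) {..<n}" using f(1) by (rule bij_betw_cong[THEN iffD1, rotated]) simp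
  then have "bij_betw ?g (insert v (V - {v})) ({..<n} \<union> {n})"
    using notIn_Un_bij_betw[of v "V - {v}" ?g "{..<n}"] by simp
  then have bg: "bij_betw ?g V {..<Suc n}" using v(1) by (simp add: insert_absorb lessThan_Suc)
  have "(M(n := map f (N v))) (?g u) = map ?g (N u)" if u: "u \<in> V" for u
  proof (cases "u = v")
    case False
    then have "f u < n" using u f(1) bij_betwE by fastforce
    then show ?thesis using False u f(2) gN by simp
  qed (use gN u in simp)
  moreover have "source_cons n (map f (N v)) p = map ?g (v # S)"
  proof -
    have "inj_on f (V - {v})" using f(1) by (simp add: bij_betw_def)
    then have "f x \<notin> f ` set (N v)" if "x \<in> set S" for x
      using inj_on_image_mem_iff[of f "V - {v}" x "set (N v)"] SV NV[OF v(1)] that by blast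
    then have "filter (\<lambda>x. x \<notin> f ` set (N v)) (map f S) = map f S"
      by (simp add: filter_id_conv)
    moreover have "filter (\<lambda>x. x \<notin> f ` set (N v)) (map f ?T) = []"
      by (simp add: filter_empty_conv)
    moreover have "map ?g S = map f S" using SV by auto
    ultimately show ?thesis by (simp add: source_cons_def f(3))
  qed
  ultimately show ?thesis using bg by (simp add: adj_iso_def)
qed

text \<open>These are the possible out-neighbour lists of a new source, when \<open>B\<close> is the
  set of vertices it may cover. They turn out to be counted by the variations.\<close>

definition injective_words :: "'a set \<Rightarrow> 'a list set" where
  "injective_words B = {l. distinct l \<and> set l \<subseteq> B}"

text \<open>Fixing one representative per class gives the letters of a word a definite meaning as
  vertices, and equal classes get literally the same neighbour function.\<close>

definition some_rep :: "nat doag set \<Rightarrow> nat \<times> nat \<times> (nat \<Rightarrow> nat list)" where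
  "some_rep X = (SOME (n, p, N). doag_rep X n p N)"

lemma some_rep:
  assumes "X \<in> doag_classes n K"
  obtains p N where "some_rep X = (n, p, N)" "doag_rep X n p N" "p \<in> K"
proof -
  obtain N p where 1: "doag_rep X n p N" "p \<in> K" using doag_classes_rep[OF assms] .
  obtain m q M where 2: "some_rep X = (m, q, M)" by (cases "some_rep X") auto
  have "case some_rep X of (n, p, N) \<Rightarrow> doag_rep X n p N"
    unfolding some_rep_def by (rule someI[of _ "(n, p, N)"]) (use 1 in simp)
  then have "doag_rep X m q M" using 2 by simp
  with doag_rep_unique[OF 1(1) this] 1(2) 2 that show ?thesis by blast
qed

definition extend :: "nat doag set \<times> nat list \<Rightarrow> nat doag set" where
  "extend = (\<lambda>(X, l). case some_rep X of (n, p, N) \<Rightarrow>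
     dclass {..<Suc n} (N(n := l)) (source_cons n l p))"

text \<open>A preimage arises by deleting the smallest source. At least \<open>k - 1\<close> old
  sources remain and lead the list of sources, so in the representative they are the smallest
  numbers.\<close>

lemma extend_surj:
  assumes "1 \<le> k" "X \<in> doag_classes (Suc n) {k..}"
  shows "X \<in> extend ` (doag_classes n {k - 1..} \<times> injective_words {k - 1..<n})"
proof -
  obtain V N S' where *: "adj_doag V N S'" "card V = Suc n" "length S' \<in> {k..}" "X = dclass V N S'"
    using doag_classes_adj[OF assms(2)] .
  then obtain v S where S': "S' = v # S" using assms(1) by (cases S') auto
  note vS = *(1)[unfolded S']
  let ?T = "S @ filter (\<lambda>w. \<forall>u\<in>V - {v}. w \<notin> set (N u)) (N v)"
  have ad: "adj_doag (V - {v}) N ?T" using adj_doag_remove_source[OF vS] .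
  have S: "insert v (set S) = {v \<in> V. \<forall>u\<in>V. v \<notin> set (N u)}" "distinct (v # S)"
    using vS by (simp_all add: adj_doag_def)
  have v: "v \<in> V" "\<And>u. u \<in> V \<Longrightarrow> v \<notin> set (N u)" using S(1) by blast+
  have cV: "card (V - {v}) = n" using *(2) v(1) by simp
  define Y where "Y = dclass (V - {v}) N ?T"
  have Y: "Y \<in> doag_classes n {k - 1..}"
    unfolding Y_def by (rule dclass_in_classes[OF ad cV]) (use *(3) S' in auto)
  obtain p M where R: "some_rep Y = (n, p, M)" "doag_rep Y n p M" using some_rep[OF Y] .
  then have M: "adj_doag {..<n} M [0..<p]" by (simp add: doag_rep_def)
  have "dclass (V - {v}) N ?T = dclass {..<n} M [0..<p]" using R(2) by (simp add: doag_rep_def Y_def)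
  then obtain f where f: "adj_iso f (V - {v}) N ?T {..<n} M [0..<p]"
    using dclass_eq_iff[OF ad M] by blast
  define l where "l = map f (N v)"
  have bf: "bij_betw f (V - {v}) {..<n}" and fT: "[0..<p] = map f ?T"
    using f by (auto simp: adj_iso_def)
  then have inj: "inj_on f (V - {v})" by (simp add: bij_betw_def)
  have NV: "set (N v) \<subseteq> V - {v}" "distinct (N v)"
    using vS v by (auto simp: adj_doag_def)
  have ln: "set l \<subseteq> {..<n}" using bf NV by (auto simp: l_def bij_betw_def)
  have "distinct l" using NV inj by (auto simp: l_def distinct_map intro: inj_on_subset)
  \<comment> \<open>The first \<open>length S\<close> vertices of the representative are the images
    of \<open>S\<close>, and \<open>v\<close> covers no member of \<open>S\<close>.\<close>
  have "k - 1 \<le> x" if x: "x \<in> set l" for x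
  proof (rule ccontr)
    assume "\<not> k - 1 \<le> x"
    then have "x < length S" using *(3) S' by auto
    moreover have "p \<ge> length S" using arg_cong[OF fT, of length] by simp
    ultimately have "[0..<p] ! x = f (S ! x)" "x < p" by (auto simp: fT nth_append)
    then have "x = f (S ! x)" by simp
    then have "f (S ! x) \<in> f ` set (N v)" using x by (simp add: l_def)
    moreover have "S ! x \<in> set S" using \<open>x < length S\<close> by simp
    then have "S ! x \<in> V - {v}" "S ! x \<notin> set (N v)" using S v by auto
    ultimately show False using inj_on_image_mem_iff[OF inj _ NV(1)] by blast
  qed
  then have l: "l \<in> injective_words {k - 1..<n}"
    using ln \<open>distinct l\<close> by (auto simp: injective_words_def)
  have "X = dclass {..<Suc n} (M(n := l)) (source_cons n l p)"
    unfolding *(4) S' l_def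
    using dclass_eq_iff[OF vS adj_doag_source_cons[OF M]] adj_iso_source_cons[OF vS f]
      \<open>distinct l\<close> ln l_def by blast
  also have "\<dots> = extend (Y, l)" by (simp add: extend_def R(1))
  finally show ?thesis using Y l by blast
qed

text \<open>The neighbour lists alone fix the set of sources. With a single source this also fixes
  the list.\<close>

lemma adj_iso_sources_image:
  assumes "adj_doag V N S" "adj_doag V' N' S'"
    and "bij_betw f V V'" "\<And>v. v \<in> V \<Longrightarrow> N' (f v) = map f (N v)"
  shows "set S' = f ` set S"
proof -
  have "adj_doag V' N' (map f S)" using adj_iso_image[OF assms(1,3), of N'] assms(4) by blast
  then have "set (map f S) = set S'" using assms(2) unfolding adj_doag_def by blast
  then show ?thesis by simp
qed

text \<open>An isomorphism between the extensions fixes the new vertex, which is the first source on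
  both sides, and so restricts to the old vertices. Once it is known to respect the old order of
  sources, the classes agree, and rigidity makes the restriction the identity, so the words agree
  too.\<close>

lemma extend_inj:
  assumes "X \<in> doag_classes n {k}" "Y \<in> doag_classes n {k}"
    and "l \<in> injective_words {..<n}" "l' \<in> injective_words {..<n}"
    and cond: "k = 1 \<or> set l \<inter> {..<k} = {} \<and> set l' \<inter> {..<k} = {}"
    and eq: "extend (X, l) = extend (Y, l')"
  shows "X = Y \<and> l = l'"
proof -
  obtain N where X: "some_rep X = (n, k, N)" "doag_rep X n k N" using some_rep[OF assms(1)] by blast
  obtain M where Y: "some_rep Y = (n, k, M)" "doag_rep Y n k M" using some_rep[OF assms(2)] by blast
  have N: "adj_doag {..<n} N [0..<k]" "X = dclass {..<n} N [0..<k]" using X(2) by (auto simp: doag_rep_def)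
  have M: "adj_doag {..<n} M [0..<k]" "Y = dclass {..<n} M [0..<k]" using Y(2) by (auto simp: doag_rep_def)
  have l: "distinct l" "set l \<subseteq> {..<n}" "distinct l'" "set l' \<subseteq> {..<n}"
    using assms(3,4) by (auto simp: injective_words_def)
  have "dclass {..<Suc n} (N(n := l)) (source_cons n l k) = dclass {..<Suc n} (M(n := l')) (source_cons n l' k)"
    using eq X(1) Y(1) by (simp add: extend_def)
  then obtain f where f: "adj_iso f {..<Suc n} (N(n := l)) (source_cons n l k)
      {..<Suc n} (M(n := l')) (source_cons n l' k)"
    using dclass_eq_iff[OF adj_doag_source_cons[OF N(1) l(1,2)] adj_doag_source_cons[OF M(1) l(3,4)]] by blast
  then have fn: "f n = n" by (simp add: adj_iso_def source_cons_def)
  have bf: "bij_betw f {..<Suc n} {..<Suc n}" using f by (simp add: adj_iso_def)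
  have "bij_betw f ({..<Suc n} - {n}) ({..<Suc n} - {n})"
    by (rule bij_betw_DiffI[OF bf]) (use fn in \<open>auto simp: bij_betw_def\<close>)
  then have bf': "bij_betw f {..<n} {..<n}" by (simp add: lessThan_Suc)
  have fN: "M (f v) = map f (N v)" if "v \<in> {..<n}" for v
  proof -
    have "f v < n" using bf' that bij_betwE by blast
    moreover have "(M(n := l')) (f v) = map f ((N(n := l)) v)"
      using f that unfolding adj_iso_def by (metis lessThan_iff less_SucI)
    ultimately show ?thesis using that by simp
  qed
  have fl: "l' = map f l" using f fn unfolding adj_iso_def by (metis fun_upd_same lessThan_iff lessI)
  \<comment> \<open>Covering sources can lose their relative order. A sole source has none to lose,
    and if no source is covered, the old list is still visible behind \<open>n\<close>.\<close>
  have "[0..<k] = map f [0..<k]"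
  proof (cases "k = 1")
    case True
    then show ?thesis using adj_iso_sources_image[OF N(1) M(1) bf' fN] by simp
  next
    case False
    with cond have "filter (\<lambda>x. x \<notin> set l) [0..<k] = [0..<k]" "filter (\<lambda>x. x \<notin> set l') [0..<k] = [0..<k]"
      by (auto simp: filter_id_conv)
    then show ?thesis using f by (simp add: adj_iso_def source_cons_def)
  qed
  then have iso: "adj_iso f {..<n} N [0..<k] {..<n} M [0..<k]" using bf' fN by (simp add: adj_iso_def)
  then have "X = Y" unfolding N(2) M(2) using dclass_eq_iff[OF N(1) M(1)] by blast
  \<comment> \<open>Both classes have the same chosen representative, so \<open>f\<close> is an
    automorphism of it and is compared with \<open>id\<close>.\<close>
  then have "N = M" using X(1) Y(1) by simp
  have "f x = id x" if "x \<in> {..<n}" for x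
  proof (rule adj_iso_unique[OF N(1) iso _ that])
    show "adj_iso id {..<n} N [0..<k] {..<n} M [0..<k]" using \<open>N = M\<close> by (simp add: adj_iso_def)
  qed
  then have "l' = l" unfolding fl using l(2) by (intro map_idI) auto
  with \<open>X = Y\<close> show ?thesis by simp
qed

lemma extend_in_classes:
  assumes "X \<in> doag_classes n {k}" "l \<in> injective_words {..<n}"
    "length (source_cons n l k) = j"
  shows "extend (X, l) \<in> doag_classes (Suc n) {j}"
proof -
  obtain N where X: "some_rep X = (n, k, N)" "doag_rep X n k N" using some_rep[OF assms(1)] by blast
  then have N: "adj_doag {..<n} N [0..<k]" by (auto simp: doag_rep_def)
  have l: "distinct l" "set l \<subseteq> {..<n}" using assms(2) by (auto simp: injective_words_def)
  show ?thesis
    unfolding extend_def using X(1) dclass_in_classes[OF adj_doag_source_cons[OF N l]] assms(3) by simp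
qed

subsection \<open>Counting\<close>

lemma finite_injective_words: "finite B \<Longrightarrow> finite (injective_words B)"
  unfolding injective_words_def
  by (rule finite_subset[OF _ finite_subset_distinct]) auto

lemma card_injective_words_image:
  assumes "inj_on f B"
  shows "card (injective_words (f ` B)) = card (injective_words B)"
proof -
  have "inj_on (map f) (injective_words B)"
    using assms by (intro inj_on_mapI) (auto simp: injective_words_def intro: inj_on_subset)
  moreover have "map f ` injective_words B = injective_words (f ` B)"
  proof (intro equalityI subsetI)
    fix l assume l: "l \<in> injective_words (f ` B)"
    define m where "m = map (inv_into B f) l"
    have "map f m = l" using l by (auto simp: m_def injective_words_def f_inv_into_f intro!: map_idI)
    moreover have "m \<in> injective_words B"
      using l by (auto simp: m_def injective_words_def distinct_map inv_into_into
          intro: inj_on_subset[OF inj_on_inv_into])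
    ultimately show "l \<in> map f ` injective_words B" by blast
  next
    fix l assume "l \<in> map f ` injective_words B"
    then obtain m where m: "l = map f m" "distinct m" "set m \<subseteq> B" by (auto simp: injective_words_def)
    then show "l \<in> injective_words (f ` B)"
      using inj_on_subset[OF assms m(3)] by (auto simp: injective_words_def distinct_map)
  qed
  ultimately show ?thesis using card_image by metis
qed

lemma variation_Suc_index:
  assumes "is_variation xs" "i < length xs" "j < length xs" "xs ! i = Suc t" "xs ! j = Suc t"
  shows "i = j"
proof (rule ccontr)
  assume "i \<noteq> j"
  have "card {i, j} \<le> card {m. m < length xs \<and> xs ! m = Suc t}"
    using assms by (intro card_mono) auto
  also have "\<dots> = count_list xs (Suc t)"
    by (simp add: count_list_eq_length_filter length_filter_conv_card eq_commute)
  also have "\<dots> \<le> 1" using assms(1) by (simp add: is_variation_def)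
  finally show False using \<open>i \<noteq> j\<close> by simp
qed

text \<open>The variation of a word records at position \<open>i\<close> the rank of the letter \<open>i\<close> in the word,
  counted from 1, or 0 if the letter is absent.\<close>

lemma num_variations_eq_card_lessThan: "num_variations c = card (injective_words {..<c})"
proof -
  define \<phi> where "\<phi> l = map (\<lambda>i. if i \<in> set l then Suc (THE t. t < length l \<and> l ! t = i) else 0) [0..<c]"
    for l :: "nat list"
  have the: "(THE t. t < length l \<and> l ! t = l ! s) = s" if "distinct l" "s < length l" for l :: "nat list" and s
    using that by (intro the_equality) (auto simp: nth_eq_iff_index_eq)
  have nth: "\<phi> l ! (l ! s) = Suc s" if "l \<in> injective_words {..<c}" "s < length l" for l s
  proof -
    have "l ! s < c" "distinct l"
      using that nth_mem[OF that(2)] by (auto simp: injective_words_def simp del: nth_mem)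
    then show ?thesis using that the by (simp add: \<phi>_def)
  qed
  \<comment> \<open>The positive entries of \<open>\<phi> l\<close> encode the inverse of the
    partial enumeration \<open>l\<close>, so they determine \<open>l\<close>.\<close>
  have rank: "\<phi> l ! i = Suc t \<longleftrightarrow> t < length l \<and> l ! t = i"
    if "l \<in> injective_words {..<c}" "i < c" for l i t
  proof (cases "i \<in> set l")
    case True
    then obtain s where s: "s < length l" "l ! s = i" by (auto simp: in_set_conv_nth)
    with nth[OF that(1) s(1)] show ?thesis
      using that(1) by (auto simp: injective_words_def nth_eq_iff_index_eq)
  next
    case False
    then show ?thesis using that(2) by (auto simp: \<phi>_def)
  qed
  have len: "length (\<phi> l) = c" for l by (simp add: \<phi>_def)
  have "inj_on \<phi> (injective_words {..<c})"
  proof (rule inj_onI)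
    fix l m assume l: "l \<in> injective_words {..<c}" and m: "m \<in> injective_words {..<c}" and eq: "\<phi> l = \<phi> m"
    have *: "s < length b \<and> b ! s = a ! s"
      if "a \<in> injective_words {..<c}" "b \<in> injective_words {..<c}" "\<phi> a = \<phi> b" "s < length a" for a b s
    proof -
      have "a ! s < c"
        using that(1) nth_mem[OF that(4)] by (auto simp: injective_words_def simp del: nth_mem)
      with that rank show ?thesis by metis
    qed
    have "length l = length m"
      using *[OF l m eq] *[OF m l eq[symmetric]] by (meson linorder_neqE_nat less_irrefl)
    then show "l = m" using *[OF m l eq[symmetric]] by (auto intro: nth_equalityI)
  qed
  moreover have "\<phi> ` injective_words {..<c} = {xs. length xs = c \<and> is_variation xs}"
  proof (intro equalityI subsetI)
    fix xs assume "xs \<in> \<phi> ` injective_words {..<c}"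
    then obtain l where l: "l \<in> injective_words {..<c}" "xs = \<phi> l" by blast
    have "count_list xs i \<le> 1" if "0 < i" for i
    proof -
      obtain t where t: "i = Suc t" using \<open>0 < i\<close> gr0_implies_Suc by blast
      have "count_list xs i = card {m. m < c \<and> xs ! m = Suc t}"
        using len l(2) t by (simp add: count_list_eq_length_filter length_filter_conv_card eq_commute)
      also have "\<dots> \<le> card {l ! t}"
        by (rule card_mono) (use rank[OF l(1)] l(2) in auto)
      finally show ?thesis by simp
    qed
    moreover have "i \<in> set xs" if ij: "0 < i" "i < j" "j \<in> set xs" for i j
    proof -
      obtain s t where st: "i = Suc s" "j = Suc t" "s < t"
        using ij(1,2) by (cases i; cases j) auto
      obtain m where "m < c" "xs ! m = Suc t" using ij(3) len st(2) l(2) by (auto simp: in_set_conv_nth)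
      then have "t < length l" using rank[OF l(1)] l(2) by blast
      then have "s < length l" using st(3) by simp
      moreover have "l ! s < c"
        using l(1) nth_mem[OF \<open>s < length l\<close>] by (auto simp: injective_words_def simp del: nth_mem)
      ultimately show ?thesis
        using nth[OF l(1)] len l(2) st(1) nth_mem[of "l ! s" xs] by simp
    qed
    ultimately show "xs \<in> {xs. length xs = c \<and> is_variation xs}"
      using len l(2) by (auto simp: is_variation_def)
  next
    fix xs assume "xs \<in> {xs. length xs = c \<and> is_variation xs}"
    then have xs: "length xs = c" "is_variation xs" by auto
    \<comment> \<open>By downward closure the positive entries are exactly the numbers from 1 to
      \<open>j\<close>, so \<open>j\<close> is the length of the word to be recovered. The inserted
      0 covers the empty list.\<close>
    define j where "j = Max (insert 0 (set xs))"
    have j: "Suc t \<in> set xs \<longleftrightarrow> t < j" for t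
    proof
      assume "Suc t \<in> set xs"
      then have "Suc t \<le> j" unfolding j_def by (intro Max_ge) auto
      then show "t < j" by simp
    next
      assume "t < j"
      moreover have "j \<in> insert 0 (set xs)" unfolding j_def by (rule Max_in) auto
      ultimately have "j \<in> set xs" by auto
      then show "Suc t \<in> set xs"
        using \<open>t < j\<close> xs(2) unfolding is_variation_def by (metis Suc_lessI zero_less_Suc)
    qed
    have "\<exists>i<c. xs ! i = Suc t" if "t < j" for t
      using that j[of t] unfolding in_set_conv_nth xs(1) by simp
    \<comment> \<open>\<open>g t\<close> is the position of the entry \<open>Suc t\<close>, that is,
      the letter at place \<open>t\<close> of the word.\<close>
    then obtain g where g: "\<And>t. t < j \<Longrightarrow> g t < c \<and> xs ! g t = Suc t" by metis
    define l where "l = map g [0..<j]"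
    have "inj_on g {0..<j}"
    proof (rule inj_onI)
      fix s t assume "s \<in> {0..<j}" "t \<in> {0..<j}" "g s = g t"
      then have "Suc s = Suc t" using g[of s] g[of t] by (metis atLeastLessThan_iff)
      then show "s = t" by simp
    qed
    then have l: "l \<in> injective_words {..<c}"
      using g by (auto simp: l_def injective_words_def distinct_map)
    have "xs ! i = \<phi> l ! i" if "i < c" for i
    proof -
      have "xs ! i = Suc t \<longleftrightarrow> t < j \<and> g t = i" for t
      proof (intro iffI)
        assume a: "xs ! i = Suc t"
        then have "t < j" using j[of t] nth_mem[of i xs] xs(1) that by simp
        then show "t < j \<and> g t = i" using g[of t] variation_Suc_index[OF xs(2)] a xs(1) that by metis
      next
        assume "t < j \<and> g t = i"
        then show "xs ! i = Suc t" using g[of t] by blast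
      qed
      moreover have "t < length l \<and> l ! t = i \<longleftrightarrow> t < j \<and> g t = i" for t by (auto simp: l_def)
      ultimately have "xs ! i = Suc t \<longleftrightarrow> \<phi> l ! i = Suc t" for t
        using rank[OF l that, of t] by metis
      then show ?thesis by (metis not0_implies_Suc)
    qed
    then have "xs = \<phi> l" using xs(1) len by (intro nth_equalityI) auto
    then show "xs \<in> \<phi> ` injective_words {..<c}" using l by blast
  qed
  ultimately show ?thesis unfolding num_variations_def using card_image by metis
qed

lemma card_injective_words:
  assumes "finite B"
  shows "card (injective_words B) = num_variations (card B)"
proof -
  obtain f where "bij_betw f {..<card B} B"
    using ex_bij_betw_nat_finite[OF assms] by (auto simp: lessThan_atLeast0)
  then show ?thesis
    using card_injective_words_image[of f "{..<card B}"] num_variations_eq_card_lessThan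
    by (simp add: bij_betw_def)
qed

text \<open>A nonempty word consists of a first letter and a word over the remaining
  \<open>c\<close> letters; the summand 1 is the empty word.\<close>

lemma num_variations_Suc: "num_variations (Suc c) = 1 + Suc c * num_variations c"
proof -
  let ?B = "{..<Suc c}"
  let ?C = "\<lambda>x. (#) x ` injective_words (?B - {x})"
  have "injective_words ?B = insert [] (\<Union>x\<in>?B. ?C x)"
  proof (intro equalityI subsetI)
    fix l assume "l \<in> injective_words ?B"
    then show "l \<in> insert [] (\<Union>x\<in>?B. ?C x)"
      by (cases l) (auto simp: injective_words_def image_iff)
  qed (auto simp: injective_words_def)
  moreover have "card (\<Union>x\<in>?B. ?C x) = (\<Sum>x\<in>?B. card (?C x))"
    by (rule card_UN_disjoint) (auto simp: finite_injective_words)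
  moreover have "card (?C x) = num_variations c" if "x \<in> ?B" for x
    using that by (simp add: card_image card_injective_words)
  moreover have "finite (\<Union>x\<in>?B. ?C x)" by (simp add: finite_injective_words)
  ultimately have "card (injective_words ?B) = Suc (\<Sum>x\<in>?B. num_variations c)"
    by (simp add: card_insert_if image_iff del: sum_constant)
  then show ?thesis by (simp add: num_variations_eq_card_lessThan)
qed

lemma num_variations_pos: "0 < num_variations c"
proof -
  have "[] \<in> injective_words {..<c}" by (simp add: injective_words_def)
  then show ?thesis
    unfolding num_variations_eq_card_lessThan by (metis card_gt_0_iff empty_iff finite_injective_words finite_lessThan)
qed

section \<open>Recursive inequalities for the numbers of DOAGs\<close>

lemma card_doag_classes_le:
  assumes "1 \<le> k"
  shows "card (doag_classes (Suc n) {k..}) \<le> num_variations (Suc n - k) * card (doag_classes n {k - 1..})"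
proof -
  let ?A = "doag_classes n {k - 1..} \<times> injective_words {k - 1..<n}"
  have fin: "finite ?A" by (simp add: finite_doag_classes finite_injective_words)
  have "card (doag_classes (Suc n) {k..}) \<le> card (extend ` ?A)"
    using extend_surj[OF assms] fin by (intro card_mono) auto
  also have "\<dots> \<le> card ?A" using fin by (rule card_image_le)
  \<comment> \<open>The alphabet has \<open>n - (k - 1)\<close> letters, which is
    \<open>Suc n - k\<close> as \<open>k\<close> is positive.\<close>
  also have "\<dots> = num_variations (Suc n - k) * card (doag_classes n {k - 1..})"
    using assms by (simp add: card_cartesian_product card_injective_words mult.commute)
  finally show ?thesis .
qed

lemma num_doags_le: "num_doags (Suc n) \<le> num_variations n * num_doags n"
  using card_doag_classes_le[of 1 n] doag_classes_nonzero_sources[of "Suc n"]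
  by (simp add: num_doags_eq atLeast_0)

lemma num_doags_split:
  assumes "0 < n"
  shows "num_doags n = num_doags_src n 1 + card (doag_classes n {2..})"
proof -
  have "{1::nat..} = {1} \<union> {2..}" by auto
  then have "doag_classes n UNIV = doag_classes n {1} \<union> doag_classes n {2..}"
    using doag_classes_nonzero_sources[OF assms] doag_classes_Un by metis
  moreover have "doag_classes n {1} \<inter> doag_classes n {2..} = {}" by (rule doag_classes_disjoint) simp
  ultimately show ?thesis
    by (simp add: num_doags_eq num_doags_src_eq card_Un_disjoint finite_doag_classes)
qed

text \<open>Compared with \<open>num_doags_le\<close> at \<open>Suc n\<close>, the alphabet loses
  one letter, and the bound shrinks by a factor of order \<open>n\<close>. This makes several
  sources rare.\<close>

lemma many_sources_le: "card (doag_classes (Suc (Suc n)) {2..}) \<le> num_variations n * num_doags (Suc n)"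
  using card_doag_classes_le[of 2 "Suc n"] doag_classes_nonzero_sources[of "Suc n"]
  by (simp add: num_doags_eq)

text \<open>Each deletion lowers the numbers of vertices and of required sources together. Their
  difference stays \<open>m - 1\<close>, and every step contributes the same factor.\<close>

lemma num_doags_src_le: "num_doags_src (m + k) (Suc k) \<le> num_variations (m - 1) ^ k * num_doags m"
proof -
  have "card (doag_classes (m + k) {Suc k..}) \<le> num_variations (m - 1) ^ k * num_doags m"
  proof (induction k)
    case 0
    show ?case unfolding num_doags_eq
      by (simp add: card_mono finite_doag_classes doag_classes_mono)
  next
    case (Suc k)
    have "card (doag_classes (m + Suc k) {Suc (Suc k)..}) \<le> num_variations (m - 1) * card (doag_classes (m + k) {Suc k..})"
      using card_doag_classes_le[of "Suc (Suc k)" "m + k"] by simp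
    also have "\<dots> \<le> num_variations (m - 1) * (num_variations (m - 1) ^ k * num_doags m)"
      using Suc.IH by (rule mult_le_mono2)
    finally show ?case by (simp add: mult.assoc)
  qed
  moreover have "num_doags_src (m + k) (Suc k) \<le> card (doag_classes (m + k) {Suc k..})"
    unfolding num_doags_src_eq by (intro card_mono finite_doag_classes doag_classes_mono) auto
  ultimately show ?thesis by (rule order_trans[rotated])
qed

text \<open>Words over the \<open>n - k\<close> vertices that are not sources leave all old sources
  uncovered, and insertion is injective on them.\<close>

lemma num_doags_src_Suc_ge:
  "num_variations (n - k) * num_doags_src n k \<le> num_doags_src (Suc n) (Suc k)"
proof (cases "doag_classes n {k} = {}")
  case False
  let ?A = "doag_classes n {k} \<times> injective_words {k..<n}"
  have sub: "injective_words {k..<n} \<subseteq> injective_words {..<n}"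
    by (auto simp: injective_words_def)
  have dis: "set l \<inter> {..<k} = {}" if "l \<in> injective_words {k..<n}" for l
    using that by (auto simp: injective_words_def)
  have "card ?A = card (extend ` ?A)"
  proof (rule card_image[symmetric], rule inj_onI, clarify)
    fix X l Y l' assume "X \<in> doag_classes n {k}" "Y \<in> doag_classes n {k}"
      "l \<in> injective_words {k..<n}" "l' \<in> injective_words {k..<n}" "extend (X, l) = extend (Y, l')"
    then show "X = Y \<and> l = l'" using extend_inj[of X n k Y l l'] sub dis by blast
  qed
  also have "\<dots> \<le> card (doag_classes (Suc n) {Suc k})"
  proof (rule card_mono[OF finite_doag_classes], clarify)
    fix X l assume a: "X \<in> doag_classes n {k}" "l \<in> injective_words {k..<n}"
    then have "filter (\<lambda>x. x \<notin> set l) [0..<k] = [0..<k]"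
      using dis[OF a(2)] by (auto simp: filter_id_conv)
    then show "extend (X, l) \<in> doag_classes (Suc n) {Suc k}"
      using extend_in_classes[OF a(1)] a(2) sub by (auto simp: source_cons_def)
  qed
  finally show ?thesis
    by (simp add: card_cartesian_product card_injective_words num_doags_src_eq mult.commute)
qed (simp add: num_doags_src_eq)

lemma num_doags_src_ge: "num_variations (m - 1) ^ k * num_doags_src m 1 \<le> num_doags_src (m + k) (Suc k)"
proof (induction k)
  case (Suc k)
  have "num_variations (m - 1) * (num_variations (m - 1) ^ k * num_doags_src m 1)
      \<le> num_variations (m - 1) * num_doags_src (m + k) (Suc k)"
    using Suc.IH by (rule mult_le_mono2)
  also have "\<dots> \<le> num_doags_src (m + Suc k) (Suc (Suc k))"
    using num_doags_src_Suc_ge[of "m + k" "Suc k"] by simp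
  finally show ?case by (simp add: mult.assoc)
qed simp

text \<open>The difference counts the words that contain 0, the only old source. The inserted vertex
  then becomes the only source.\<close>

lemma num_doags_one_source_ge:
  "(num_variations (Suc n) - num_variations n) * num_doags_src (Suc n) 1 \<le> num_doags_src (Suc (Suc n)) 1"
proof -
  let ?n = "Suc n"
  let ?W = "injective_words {..<?n} - injective_words {1..<?n}"
  let ?A = "doag_classes ?n {1} \<times> ?W"
  have W: "0 \<in> set l" if "l \<in> ?W" for l
    using that by (force simp: injective_words_def subset_iff Suc_le_eq intro: gr0I)
  have "card ?W = num_variations ?n - num_variations n"
  proof -
    have "injective_words {1..<?n} \<subseteq> injective_words {..<?n}" by (auto simp: injective_words_def)
    from card_Diff_subset[OF finite_injective_words this] show ?thesis
      by (simp add: card_injective_words)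
  qed
  moreover have "card ?A = card (extend ` ?A)"
  proof (rule card_image[symmetric], rule inj_onI, clarify)
    fix X l Y l' assume "X \<in> doag_classes ?n {1}" "Y \<in> doag_classes ?n {1}"
      "l \<in> injective_words {..<?n}" "l' \<in> injective_words {..<?n}" "extend (X, l) = extend (Y, l')"
    then show "X = Y \<and> l = l'" using extend_inj[of X ?n 1 Y l l'] by blast
  qed
  moreover have "card (extend ` ?A) \<le> card (doag_classes (Suc ?n) {1})"
  proof (rule card_mono[OF finite_doag_classes], rule image_subsetI)
    fix p assume "p \<in> ?A"
    then obtain X l where p: "p = (X, l)" "X \<in> doag_classes ?n {1}" "l \<in> ?W" by blast
    with W[of l] show "extend p \<in> doag_classes (Suc ?n) {1}"
      using extend_in_classes[of X ?n 1 l 1] by (auto simp: source_cons_def)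
  qed
  ultimately show ?thesis
    by (simp add: card_cartesian_product num_doags_src_eq mult.commute)
qed

lemma num_doags_src_one: "0 < num_doags_src 1 1"
proof -
  have "adj_doag {..<1} (\<lambda>_. []) [0::nat]" by (auto simp: adj_doag_def)
  then have "dclass {..<1} (\<lambda>_. []) [0] \<in> doag_classes 1 {1}" by (rule dclass_in_classes) auto
  then show ?thesis unfolding num_doags_src_eq using finite_doag_classes card_gt_0_iff by blast
qed

subsection \<open>Asymptotics\<close>

lemma num_variations_Suc_real:
  "real (num_variations (Suc c)) = 1 + real (Suc c) * real (num_variations c)"
  by (simp add: num_variations_Suc algebra_simps)

section \<open>The proportion of DOAGs with a single source\<close>

lemma num_doags_src_one_pos: "0 < num_doags_src (Suc n) 1"
proof (induction n)
  case 0
  show ?case using num_doags_src_one by simp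
next
  case (Suc n)
  have "0 < num_variations (Suc n) - num_variations n" by (simp add: num_variations_Suc)
  with Suc num_doags_one_source_ge[of n] show ?case
    by (metis gr0I mult_is_0 not_gr0 le_zero_eq)
qed

lemma num_doags_src_one_le: "num_doags_src (Suc n) 1 \<le> num_doags (Suc n)"
  using num_doags_split[of "Suc n"] by simp

lemma num_doags_pos: "0 < num_doags (Suc n)"
  using num_doags_src_one_pos[of n] num_doags_src_one_le[of n] by linarith

text \<open>The index is shifted by one so that the denominator is always positive;
  \<open>source_ratio (n - k)\<close> then belongs to DOAGs with \<open>n - k + 1\<close>
  vertices.\<close>

definition source_ratio :: "nat \<Rightarrow> real" where
  "source_ratio n = real (num_doags (Suc n)) / real (num_doags_src (Suc n) 1)"

lemma source_ratio_ge_1: "1 \<le> source_ratio n"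
  using num_doags_src_one_pos[of n] num_doags_src_one_le[of n] by (simp add: source_ratio_def)

lemma num_doags_one_source_ge_real:
  "(1 + real n * real (num_variations n)) * real (num_doags_src (Suc n) 1)
     \<le> real (num_doags_src (Suc (Suc n)) 1)"
proof -
  have "num_variations (Suc n) - num_variations n = 1 + n * num_variations n"
    by (simp add: num_variations_Suc)
  then have "(1 + n * num_variations n) * num_doags_src (Suc n) 1 \<le> num_doags_src (Suc (Suc n)) 1"
    using num_doags_one_source_ge[of n] by simp
  then have "real ((1 + n * num_variations n) * num_doags_src (Suc n) 1) \<le> real (num_doags_src (Suc (Suc n)) 1)"
    by (rule of_nat_mono)
  then show ?thesis by (simp add: algebra_simps)
qed

text \<open>The DOAGs with several sources number at most \<open>v * d\<close>, and those with one
  source at least \<open>real n * v * e\<close>, so \<open>v\<close> cancels in the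
  quotient.\<close>

lemma source_ratio_Suc_le:
  assumes "0 < n"
  shows "source_ratio (Suc n) \<le> 1 + source_ratio n / real n"
proof -
  define v d e e' where "v = real (num_variations n)" and "d = real (num_doags (Suc n))"
    and "e = real (num_doags_src (Suc n) 1)" and "e' = real (num_doags_src (Suc (Suc n)) 1)"
  have pos: "v > 0" "d > 0" "e > 0" "e' > 0" "real n > 0"
    using assms num_variations_pos num_doags_pos num_doags_src_one_pos
    by (simp_all add: v_def d_def e_def e'_def)
  have "num_doags (Suc (Suc n)) \<le> num_doags_src (Suc (Suc n)) 1 + num_variations n * num_doags (Suc n)"
    using num_doags_split[of "Suc (Suc n)"] many_sources_le[of n] by simp
  then have "real (num_doags (Suc (Suc n))) \<le> real (num_doags_src (Suc (Suc n)) 1 + num_variations n * num_doags (Suc n))"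
    by (rule of_nat_mono)
  then have "real (num_doags (Suc (Suc n))) \<le> e' + v * d" by (simp add: v_def d_def e'_def)
  then have "source_ratio (Suc n) \<le> (e' + v * d) / e'"
    using pos unfolding source_ratio_def e'_def by (intro divide_right_mono) auto
  also have "\<dots> = 1 + v * d / e'" using pos by (simp add: field_simps)
  also have "v * d / e' \<le> v * d / (real n * v * e)"
  proof (rule divide_left_mono)
    show "real n * v * e \<le> e'"
      using num_doags_one_source_ge_real[of n] pos
      by (simp add: v_def e_def e'_def algebra_simps)
  qed (use pos in auto)
  also have "\<dots> = source_ratio n / real n"
    using pos by (simp add: source_ratio_def d_def e_def field_simps)
  finally show ?thesis by simp
qed

lemma source_ratio_bounded: "\<exists>B. \<forall>n\<ge>2. source_ratio n \<le> B"
proof (intro exI allI impI)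
  \<comment> \<open>From index 2 on the recursion divides by at least 2, so an invariant bound
    \<open>B\<close> has to satisfy 1 + B/2 \<le> B, that is, 2 \<le> B.\<close>
  let ?B = "max 2 (source_ratio 2)"
  fix n :: nat assume "2 \<le> n"
  then show "source_ratio n \<le> ?B"
  proof (induction n rule: dec_induct)
    case (step n)
    have "source_ratio (Suc n) \<le> 1 + source_ratio n / real n"
      using step.hyps by (intro source_ratio_Suc_le) simp
    also have "source_ratio n / real n \<le> ?B / 2"
      using step source_ratio_ge_1[of n] by (intro frac_le) auto
    finally show ?case by linarith
  qed simp
qed

lemma source_ratio_tendsto: "source_ratio \<longlonglongrightarrow> 1"
proof -
  obtain B where B: "\<And>n. n \<ge> 2 \<Longrightarrow> source_ratio n \<le> B" using source_ratio_bounded by blast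
  have "(\<lambda>n. source_ratio (Suc n)) \<longlonglongrightarrow> 1"
  proof (rule tendsto_sandwich[of "\<lambda>_. 1" _ _ "\<lambda>n. 1 + B / real n"])
    show "\<forall>\<^sub>F n in sequentially. source_ratio (Suc n) \<le> 1 + B / real n"
      using eventually_ge_at_top[of 2]
    proof eventually_elim
      case (elim n)
      then have "source_ratio n / real n \<le> B / real n" using B by (intro divide_right_mono) auto
      then show ?case using source_ratio_Suc_le[of n] elim by simp
    qed
    show "(\<lambda>n. 1 + B / real n) \<longlonglongrightarrow> 1"
      using tendsto_add[OF tendsto_const lim_const_over_n[of B]] by simp
  qed (simp_all add: source_ratio_ge_1)
  then show ?thesis by (rule LIMSEQ_imp_Suc)
qed

lemma num_doags_src_bounds:
  assumes "1 \<le> k" "k < n"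
  defines "w \<equiv> real (num_variations (n - k)) ^ (k - 1) * real (num_doags (n - k + 1))"
  shows "w / source_ratio (n - k) \<le> real (num_doags_src n k)" "real (num_doags_src n k) \<le> w" "0 < w"
proof -
  \<comment> \<open>With \<open>m = Suc (n - k)\<close>, adding \<open>k - 1\<close> first sources
    leads from \<open>m\<close> vertices to \<open>n\<close>. Dividing \<open>w\<close> by the ratio
    replaces all DOAGs on \<open>m\<close> vertices by those with one source.\<close>
  have eq: "Suc (n - k) + (k - 1) = n" "Suc (k - 1) = k" using assms by auto
  have "real (num_variations (n - k) ^ (k - 1) * num_doags_src (Suc (n - k)) 1) \<le> real (num_doags_src n k)"
    using num_doags_src_ge[of "Suc (n - k)" "k - 1"] unfolding eq by (intro of_nat_mono) simp
  moreover have "real (num_doags_src n k) \<le> real (num_variations (n - k) ^ (k - 1) * num_doags (Suc (n - k)))"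
    using num_doags_src_le[of "Suc (n - k)" "k - 1"] unfolding eq by (intro of_nat_mono) simp
  ultimately show "w / source_ratio (n - k) \<le> real (num_doags_src n k)" "real (num_doags_src n k) \<le> w"
    using num_doags_pos[of "n - k"] by (simp_all add: w_def source_ratio_def)
  show "0 < w" using num_doags_pos[of "n - k"] num_variations_pos by (simp add: w_def)
qed

lemma filterlim_gap: "filterlim (\<lambda>x. fst x - snd x) at_top gap_at_top"
  unfolding filterlim_at_top eventually_gap_at_top by auto

section \<open>Growth rates and the power of n for fixed k\<close>

lemma shift_ratio_tendsto: "(\<lambda>n. real (n + a) / real n) \<longlonglongrightarrow> 1"
proof (rule Lim_transform_eventually)
  show "(\<lambda>n. 1 + real a / real n) \<longlonglongrightarrow> 1"
    using tendsto_add[OF tendsto_const lim_const_over_n[of "real a"]] by simp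
  show "\<forall>\<^sub>F n in sequentially. 1 + real a / real n = real (n + a) / real n"
    using eventually_gt_at_top[of 0] by eventually_elim (simp add: field_simps)
qed

text \<open>The recurrence, with all values at least 1, places \<open>num_variations (Suc c)\<close>
  between \<open>c\<close> and \<open>c + 2\<close> times \<open>num_variations c\<close>.\<close>

lemma num_variations_ratio: "(\<lambda>c. real (num_variations c) / real (num_variations (Suc c)) * real c) \<longlonglongrightarrow> 1"
proof (rule tendsto_sandwich[of "\<lambda>c. real c / real (c + 2)" _ _ "\<lambda>_. 1"])
  have v: "1 \<le> real (num_variations c)" for c using num_variations_pos[of c] by simp
  show "\<forall>\<^sub>F c in sequentially. real c / real (c + 2) \<le> real (num_variations c) / real (num_variations (Suc c)) * real c"
  proof (rule always_eventually, rule allI)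
    fix c
    have "real (num_variations (Suc c)) \<le> real (c + 2) * real (num_variations c)"
      using v[of c] by (simp add: num_variations_Suc_real algebra_simps)
    then have "1 / real (c + 2) \<le> real (num_variations c) / real (num_variations (Suc c))"
      using v[of "Suc c"] by (simp add: field_simps)
    from mult_right_mono[OF this, of "real c"]
    show "real c / real (c + 2) \<le> real (num_variations c) / real (num_variations (Suc c)) * real c" by simp
  qed
  show "\<forall>\<^sub>F c in sequentially. real (num_variations c) / real (num_variations (Suc c)) * real c \<le> 1"
  proof (rule always_eventually, rule allI)
    fix c
    have "real (num_variations c) * real c \<le> real (num_variations (Suc c))"
      using v[of c] by (simp add: num_variations_Suc_real algebra_simps)
    then show "real (num_variations c) / real (num_variations (Suc c)) * real c \<le> 1"
      using v[of "Suc c"] by (simp add: field_simps)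
  qed
  show "(\<lambda>c. real c / real (c + 2)) \<longlonglongrightarrow> 1"
    using tendsto_divide[OF tendsto_const[of 1] shift_ratio_tendsto[of 2]] by simp
qed simp

text \<open>The lower bound 1 is \<open>num_doags_le\<close>. For the upper bound, the denominator
  is reduced to DOAGs with one source, which costs the factor \<open>source_ratio n\<close>, and the
  numerator is estimated by the recurrence for variations.\<close>

lemma num_doags_ratio:
  "(\<lambda>n. real (num_variations n) * real (num_doags n) / real (num_doags (Suc n))) \<longlonglongrightarrow> 1"
proof -
  let ?f = "\<lambda>n. real (num_variations n) * real (num_doags n) / real (num_doags (Suc n))"
  have "(\<lambda>n. ?f (Suc n)) \<longlonglongrightarrow> 1"
  proof (rule tendsto_sandwich[of "\<lambda>_. 1" _ _ "\<lambda>n. source_ratio n * ((real n + 2) / real n)"])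
    show "\<forall>\<^sub>F n in sequentially. 1 \<le> ?f (Suc n)"
    proof (rule always_eventually, rule allI)
      fix n
      have "real (num_doags (Suc (Suc n))) \<le> real (num_variations (Suc n) * num_doags (Suc n))"
        by (intro of_nat_mono num_doags_le)
      then show "1 \<le> ?f (Suc n)" using num_doags_pos[of "Suc n"] by simp
    qed
    show "\<forall>\<^sub>F n in sequentially. ?f (Suc n) \<le> source_ratio n * ((real n + 2) / real n)"
      using eventually_gt_at_top[of 0]
    proof eventually_elim
      case (elim n)
      define v d e where "v = real (num_variations n)" and "d = real (num_doags (Suc n))"
        and "e = real (num_doags_src (Suc n) 1)"
      have pos: "v \<ge> 1" "d > 0" "e > 0" "real n > 0"
        using elim num_variations_pos[of n] num_doags_pos num_doags_src_one_pos
        by (simp_all add: v_def d_def e_def Suc_le_eq)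
      have le: "real n * v * e \<le> real (num_doags (Suc (Suc n)))"
      proof -
        have "real n * v * e \<le> real (num_doags_src (Suc (Suc n)) 1)"
          using num_doags_one_source_ge_real[of n] pos by (simp add: v_def e_def algebra_simps)
        also have "\<dots> \<le> real (num_doags (Suc (Suc n)))" by (intro of_nat_mono num_doags_src_one_le)
        finally show ?thesis .
      qed
      have "?f (Suc n) \<le> ((real n + 2) * v * d) / (real n * v * e)"
      proof (rule frac_le)
        have "real (num_variations (Suc n)) \<le> (real n + 2) * v"
          using pos(1) by (simp add: num_variations_Suc_real v_def algebra_simps)
        then show "real (num_variations (Suc n)) * real (num_doags (Suc n)) \<le> (real n + 2) * v * d"
          unfolding d_def by (rule mult_right_mono) simp
      qed (use pos le in auto)
      also have "\<dots> = source_ratio n * ((real n + 2) / real n)"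
        using pos by (simp add: source_ratio_def d_def e_def field_simps)
      finally show ?case .
    qed
    have "(\<lambda>n. (real n + 2) / real n) \<longlonglongrightarrow> 1" using shift_ratio_tendsto[of 2] by (simp add: add.commute)
    from tendsto_mult[OF source_ratio_tendsto this]
    show "(\<lambda>n. source_ratio n * ((real n + 2) / real n)) \<longlonglongrightarrow> 1" by simp
  qed simp
  then show ?thesis by (rule LIMSEQ_imp_Suc)
qed

text \<open>With \<open>k = Suc j\<close> this compares the main term for \<open>k\<close> sources
  with all DOAGs. Passing to \<open>Suc j\<close> replaces \<open>j\<close> powers of one variation
  number by \<open>Suc j\<close> powers of its predecessor; each predecessor quotient costs a factor
  asymptotic to 1/n, and the leftover power is absorbed by \<open>num_doags_ratio\<close>.\<close>

lemma source_bound_tendsto: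
  "(\<lambda>n. real (num_variations (n - Suc j)) ^ j * real (num_doags (n - j)) / real (num_doags n)
     * real n ^ (Suc j choose 2)) \<longlonglongrightarrow> 1"
proof (induction j)
  case 0
  have "\<forall>\<^sub>F n in sequentially. real (num_doags n) / real (num_doags n) = 1"
    using eventually_gt_at_top[of 0]
  proof eventually_elim
    case (elim n)
    then show ?case using num_doags_pos[of "n - 1"] by simp
  qed
  then show ?case by (simp add: tendsto_eventually numeral_2_eq_2)
next
  case (Suc j)
  let ?v = "\<lambda>n. real (num_variations n)" and ?D = "\<lambda>n. real (num_doags n)"
  \<comment> \<open>Writing \<open>n = i + ?s\<close> makes all the truncated subtractions
    exact.\<close>
  let ?s = "Suc (Suc j)"
  have A: "(\<lambda>i. ?v (i + 1) ^ j * ?D (i + 2) / ?D (i + ?s) * real (i + ?s) ^ (Suc j choose 2)) \<longlonglongrightarrow> 1"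
    using LIMSEQ_ignore_initial_segment[OF Suc.IH, of ?s] by simp
  from tendsto_mult[OF num_variations_ratio shift_ratio_tendsto[of ?s]]
  have "(\<lambda>i. (?v i / ?v (Suc i) * real i) * (real (i + ?s) / real i)) \<longlonglongrightarrow> 1" by simp
  then have "(\<lambda>i. ?v i / ?v (Suc i) * real (i + ?s)) \<longlonglongrightarrow> 1"
  proof (rule Lim_transform_eventually)
    show "\<forall>\<^sub>F i in sequentially. (?v i / ?v (Suc i) * real i) * (real (i + ?s) / real i)
        = ?v i / ?v (Suc i) * real (i + ?s)"
      using eventually_gt_at_top[of 0] by eventually_elim simp
  qed
  from tendsto_power[OF this, of "Suc j"]
  have B: "(\<lambda>i. (?v i / ?v (Suc i) * real (i + ?s)) ^ Suc j) \<longlonglongrightarrow> 1" by simp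
  have C: "(\<lambda>i. ?v (Suc i) * ?D (Suc i) / ?D (Suc (Suc i))) \<longlonglongrightarrow> 1"
    using LIMSEQ_Suc[OF num_doags_ratio] .
  \<comment> \<open>The powers of \<open>?v (Suc i)\<close> cancel, because j - (j + 1) + 1 = 0, and
    the exponents of \<open>real (i + ?s)\<close> add up by Pascal's rule.\<close>
  have eq: "(?v (i + 1) ^ j * ?D (i + 2) / ?D (i + ?s) * real (i + ?s) ^ (Suc j choose 2))
      * (?v i / ?v (Suc i) * real (i + ?s)) ^ Suc j * (?v (Suc i) * ?D (Suc i) / ?D (Suc (Suc i)))
    = ?v (i + ?s - Suc (Suc j)) ^ Suc j * ?D (i + ?s - Suc j) / ?D (i + ?s) * real (i + ?s) ^ (Suc (Suc j) choose 2)" for i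
  proof -
    define x y a b c N :: real where "x = ?v i" and "y = ?v (Suc i)" and "a = ?D (Suc i)"
      and "b = ?D (Suc (Suc i))" and "c = ?D (i + ?s)" and "N = real (i + ?s)"
    have "y \<noteq> 0" "b \<noteq> 0"
      using num_variations_pos[of "Suc i"] num_doags_pos[of "Suc i"] by (simp_all add: y_def b_def)
    then have "(y ^ j * b / c * N ^ (Suc j choose 2)) * (x / y * N) ^ Suc j * (y * a / b)
        = x ^ Suc j * a / c * (N ^ (Suc j choose 2) * N ^ Suc j)"
      by (simp add: power_mult_distrib power_divide)
    also have "N ^ (Suc j choose 2) * N ^ Suc j = N ^ (Suc (Suc j) choose 2)"
      by (simp add: power_add[symmetric] numeral_2_eq_2 add.commute)
    finally show ?thesis by (simp add: x_def y_def a_def b_def c_def N_def)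
  qed
  have "(\<lambda>i. ?v (i + ?s - Suc (Suc j)) ^ Suc j * ?D (i + ?s - Suc j) / ?D (i + ?s)
      * real (i + ?s) ^ (Suc (Suc j) choose 2)) \<longlonglongrightarrow> 1"
    using tendsto_mult[OF tendsto_mult[OF A B] C] unfolding eq by simp
  then show ?case by (rule LIMSEQ_offset)
qed

theorem theorem5p6:
  shows "(\<lambda>(n, k). real (num_doags_src n k) -
             real (num_variations (n - k)) ^ (k - 1) * real (num_doags (n - k + 1)))
           \<in> o[gap_at_top](\<lambda>(n, k). real (num_doags_src n k))
       \<and> ((\<lambda>(n, k). (real (num_doags_src n k) -
             real (num_variations (n - k)) ^ (k - 1) * real (num_doags (n - k + 1)))
               / real (num_doags_src n k)) \<longlongrightarrow> 0) gap_at_top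
       \<and> (\<forall>k::nat. k \<ge> 1 \<longrightarrow>
            (\<lambda>n. real (num_doags_src n k) / real (num_doags n))
              \<sim>[at_top] (\<lambda>n. real n powi (- int (k choose 2))))"
proof (intro conjI allI impI)
  let ?w = "\<lambda>n k. real (num_variations (n - k)) ^ (k - 1) * real (num_doags (n - k + 1))"
  let ?d = "\<lambda>n k. real (num_doags_src n k)"
  have gap: "\<forall>\<^sub>F x in gap_at_top. 1 \<le> snd x \<and> snd x < fst x"
    unfolding eventually_gap_at_top by (intro exI[of _ 1]) auto
  \<comment> \<open>The relative error is controlled by a quantity that depends on
    \<open>n - k\<close> only. This is the source of the uniformity in \<open>k\<close>.\<close>
  have bound: "norm ((?d n k - ?w n k) / ?d n k) \<le> source_ratio (n - k) - 1" "0 < ?d n k"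
    if "1 \<le> k" "k < n" for n k
  proof -
    note b = num_doags_src_bounds[OF that]
    have r: "1 \<le> source_ratio (n - k)" by (rule source_ratio_ge_1)
    then have "0 < ?w n k / source_ratio (n - k)" using b(3) by (intro divide_pos_pos) auto
    with b(1) show pos: "0 < ?d n k" by linarith
    have "?w n k \<le> source_ratio (n - k) * ?d n k"
      using b(1) r by (simp add: field_simps)
    then have "?w n k / ?d n k \<le> source_ratio (n - k)" using pos by (simp add: field_simps)
    moreover have "norm ((?d n k - ?w n k) / ?d n k) = ?w n k / ?d n k - 1"
      using b(2) pos by (simp add: abs_if field_simps)
    ultimately show "norm ((?d n k - ?w n k) / ?d n k) \<le> source_ratio (n - k) - 1" by simp
  qed
  show lim: "((\<lambda>(n, k). (?d n k - ?w n k) / ?d n k) \<longlongrightarrow> 0) gap_at_top"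
  proof (rule tendsto_0_le[where K = 1])
    show "\<forall>\<^sub>F x in gap_at_top. norm (case x of (n, k) \<Rightarrow> (?d n k - ?w n k) / ?d n k)
        \<le> norm (source_ratio (fst x - snd x) - 1) * 1"
      using gap
    proof eventually_elim
      case (elim x)
      then show ?case
        using bound(1)[of "snd x" "fst x"] source_ratio_ge_1[of "fst x - snd x"]
        by (simp add: case_prod_unfold)
    qed
    show "((\<lambda>x. source_ratio (fst x - snd x) - 1) \<longlongrightarrow> 0) gap_at_top"
      using tendsto_diff[OF filterlim_compose[OF source_ratio_tendsto filterlim_gap] tendsto_const[of 1]] by simp
  qed
  show "(\<lambda>(n, k). ?d n k - ?w n k) \<in> o[gap_at_top](\<lambda>(n, k). ?d n k)"
  proof (rule smalloI_tendsto)
    show "((\<lambda>x. (case x of (n, k) \<Rightarrow> ?d n k - ?w n k) / (case x of (n, k) \<Rightarrow> ?d n k)) \<longlongrightarrow> 0) gap_at_top"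
      using lim by (simp add: case_prod_unfold)
    show "\<forall>\<^sub>F x in gap_at_top. (case x of (n, k) \<Rightarrow> ?d n k) \<noteq> 0"
      using gap by eventually_elim (use bound(2) in \<open>fastforce simp: case_prod_unfold\<close>)
  qed
  fix k :: nat assume k: "1 \<le> k"
  have k1: "Suc (k - 1) = k" using k by simp
  have Q: "(\<lambda>n. real (num_variations (n - k)) ^ (k - 1) * real (num_doags (n - (k - 1))) / real (num_doags n)
      * real n ^ (k choose 2)) \<longlonglongrightarrow> 1"
    using source_bound_tendsto[of "k - 1"] unfolding k1 .
  \<comment> \<open>For fixed \<open>k\<close> the exact count is asymptotic to the main term, being
    squeezed between it and its quotient by the ratio; \<open>Q\<close> supplies the order of the
    main term.\<close>
  have R: "(\<lambda>n. ?d n k / ?w n k) \<longlonglongrightarrow> 1"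
  proof (rule tendsto_sandwich[of "\<lambda>n. 1 / source_ratio (n - k)" _ _ "\<lambda>_. 1"])
    show "\<forall>\<^sub>F n in sequentially. 1 / source_ratio (n - k) \<le> ?d n k / ?w n k"
      using eventually_gt_at_top[of k]
      by eventually_elim (use num_doags_src_bounds[OF k] in \<open>simp add: field_simps\<close>)
    show "\<forall>\<^sub>F n in sequentially. ?d n k / ?w n k \<le> 1"
      using eventually_gt_at_top[of k]
      by eventually_elim (use num_doags_src_bounds[OF k] in \<open>simp add: field_simps\<close>)
    have "(\<lambda>n. source_ratio (n - k)) \<longlonglongrightarrow> 1"
      by (rule LIMSEQ_offset[of _ k]) (simp add: source_ratio_tendsto)
    from tendsto_divide[OF tendsto_const[of 1] this]
    show "(\<lambda>n. 1 / source_ratio (n - k)) \<longlonglongrightarrow> 1" by simp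
  qed simp
  show "(\<lambda>n. ?d n k / real (num_doags n)) \<sim>[at_top] (\<lambda>n. real n powi (- int (k choose 2)))"
  proof (rule asymp_equivI')
    have "(\<lambda>n. ?d n k / ?w n k * (real (num_variations (n - k)) ^ (k - 1) * real (num_doags (n - (k - 1)))
        / real (num_doags n) * real n ^ (k choose 2))) \<longlonglongrightarrow> 1"
      using tendsto_mult[OF R Q] by simp
    then show "(\<lambda>n. ?d n k / real (num_doags n) / real n powi (- int (k choose 2))) \<longlonglongrightarrow> 1"
    proof (rule Lim_transform_eventually)
      show "\<forall>\<^sub>F n in sequentially. ?d n k / ?w n k * (real (num_variations (n - k)) ^ (k - 1)
          * real (num_doags (n - (k - 1))) / real (num_doags n) * real n ^ (k choose 2))
          = ?d n k / real (num_doags n) / real n powi (- int (k choose 2))"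
        using eventually_gt_at_top[of k]
      proof eventually_elim
        case (elim n)
        \<comment> \<open>The two ways of writing the argument of \<open>num_doags\<close> agree for
          \<open>n > k\<close>, after which the positive main term cancels.\<close>
        have "n - (k - 1) = n - k + 1" using k elim by simp
        moreover have "x / w * (w / y * z) = x / y / inverse z" if "0 < w" for w x y z :: real
          using that by (simp add: divide_simps)
        ultimately show ?case
          using num_doags_src_bounds(3)[OF k elim] by (simp only: power_int_minus power_int_of_nat)
      qed
    qed
  qed
qed

end
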